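(* Let $N,s\in\mathbb{N}$, $\boldsymbol{z}\in\{1,\ldots,N-1\}^s$, let $\boldsymbol{\gamma}=(\gamma_u)_{u\subseteq 1:s}$ be weights with $\gamma_u\ge0$, and let $\alpha$ be an even positive integer. The squared worst-case error of the symmetrized rank-1 lattice rule in $\mathcal{H}(K_{\alpha,\boldsymbol{\gamma},s}^{\mathrm{sob(odd}+\alpha)})$ is bounded by $$\left(e^{\mathrm{wor}}(P_{N,\boldsymbol{z}}^{\mathrm{sym}};\mathcal{H}(K_{\alpha,\boldsymbol{\gamma},s}^{\mathrm{sob(odd}+\alpha)}))\right)^2\le\sum_{\emptyset\ne u\subseteq 1:s}\gamma''_u\left(\sum_{\boldsymbol{k}_u\in P_{N,\boldsymbol{z}}^{\perp,u}}\prod_{j\in u}\frac{1}{k_j^\alpha}\right)^2\le\left(e^{\mathrm{wor}}(P_{N,\boldsymbol{z}};\mathcal{H}(K_{\alpha/2,\boldsymbol{\gamma}''^{1/2},s}^{\mathrm{kor}}))\right)^4,$$ where $\gamma''_u=\gamma_u\left(3/(2^{2\alpha+1}\pi^{2\alpha})\right)^{|u|}$ for $\emptyset\ne u\subseteq 1:s$ and $\boldsymbol{\gamma}''^{1/2}=(\gamma_u''^{1/2})_{u\subseteq 1:s}$.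
   Context: $\mathbb{N}$ is the set of positive integers, $1:s=\{1,\ldots,s\}$. For a reproducing kernel $K:[0,1]^s\times[0,1]^s\to\mathbb{R}$, $\mathcal{H}(K)$ is the reproducing kernel Hilbert space of real-valued functions with kernel $K$. Point sets are finite multisets (multiplicity counts). For a finite multiset $P\subset[0,1]^s$ and a normed function space $V$, the worst-case error is $$e^{\mathrm{wor}}(P;V)=\sup_{f\in V,\ \|f\|_V\le 1}\left|\frac{1}{|P|}\sum_{\boldsymbol{x}\in P}f(\boldsymbol{x})-\int_{[0,1]^s}f(\boldsymbol{x})\,d\boldsymbol{x}\right|.$$ The rank-1 lattice point set is $P_{N,\boldsymbol{z}}=\{\{n\boldsymbol{z}/N\} : 0\le n<N\}$ (componentwise fractional parts; $N$ points with multiplicity). For $u\subseteq 1:s$ and $\boldsymbol{x}\in[0,1]^s$, $\mathrm{sym}_u(\boldsymbol{x})=(y_1,\ldots,y_s)$ with $y_j=1-x_j$ if $j\in u$ and $y_j=x_j$ otherwise. The symmetrized point set is the multiset union $P_{N,\boldsymbol{z}}^{\mathrm{sym}}=\bigcup_{u\subseteq 1:s}\mathrm{sym}_u(P_{N,\boldsymbol{z}})$, having $2^sN$ points counted with multiplicity. For non-empty $u\subseteq 1:s$, $$P_{N,\boldsymbol{z}}^{\perp,u}=\left\{\boldsymbol{k}_u=(k_j)_{j\in u}\in(\mathbb{Z}\setminus\{0\})^{|u|} : \sum_{j\in u}k_jz_j\equiv 0\pmod N\right\}.$$ Kernel of the intermediate Sobolev space: with $B_\tau$ the Bernoulli polynomial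 of degree $\tau$, $$K_{\alpha,1,1}^{\mathrm{sob(odd}+\alpha)}(x,y)=1+\sum_{\substack{1\le\tau\le\alpha\\ \tau\text{ odd or }\tau=\alpha}}\frac{B_\tau(x)B_\tau(y)}{(\tau!)^2}+(-1)^{\alpha+1}\frac{B_{2\alpha}(|x-y|)}{(2\alpha)!},$$ $$K_{\alpha,\boldsymbol{\gamma},s}^{\mathrm{sob(odd}+\alpha)}(\boldsymbol{x},\boldsymbol{y})=1+\sum_{\emptyset\ne u\subseteq 1:s}\gamma_u\prod_{j\in u}\left[-1+K_{\alpha,1,1}^{\mathrm{sob(odd}+\alpha)}(x_j,y_j)\right].$$ Korobov kernel: for weights $\boldsymbol{\eta}=(\eta_u)_{u\subseteq 1:s}$, $\eta_u\ge 0$, and $\beta>1/2$, $$K_{\beta,\boldsymbol{\eta},s}^{\mathrm{kor}}(\boldsymbol{x},\boldsymbol{y})=1+\sum_{\emptyset\ne u\subseteq 1:s}\eta_u\prod_{j\in u}\sum_{h_j\in\mathbb{Z}\setminus\{0\}}\frac{e^{2\pi\mathrm{i}h_j(x_j-y_j)}}{|h_j|^{2\beta}}.$$ (The weight for $u=\emptyset$ plays no role in the kernels.) *)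

theory Defs
  imports "HOL-Analysis.Analysis"
begin

text \<open>
  The coordinate set \<open>{1..s}\<close> is an arbitrary finite (non-empty) index type \<open>'s\<close>, so that
  \<open>s = CARD('s)\<close>, points are vectors of type \<open>real ^ 's\<close>, and \<open>cbox 0 1\<close> is the unit cube.
\<close>

section \<open>Reproducing kernel Hilbert spaces\<close>

definition fun_norm :: "(('a \<Rightarrow> real) \<Rightarrow> ('a \<Rightarrow> real) \<Rightarrow> real) \<Rightarrow> ('a \<Rightarrow> real) \<Rightarrow> real" where
  "fun_norm ip f = sqrt (ip f f)"

text \<open>
  Functions on \<open>X\<close> are represented by total functions that vanish outside \<open>X\<close>.
\<close>

definition kernel_section :: "'a set \<Rightarrow> ('a \<Rightarrow> 'a \<Rightarrow> real) \<Rightarrow> 'a \<Rightarrow> ('a \<Rightarrow> real)" where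
  "kernel_section X K x = (\<lambda>y. if y \<in> X then K y x else 0)"

text \<open>
  The set \<open>H\<close> with inner product \<open>ip\<close> is the Hilbert space \<open>\<H>(K)\<close> of functions on \<open>X\<close> with
  reproducing kernel \<open>K\<close>. By the Moore--Aronszajn theorem \<open>H\<close> and the restriction of \<open>ip\<close> to
  \<open>H\<close> exist for every positive semidefinite symmetric \<open>K\<close> and are determined by \<open>K\<close>.
\<close>

locale rkhs =
  fixes X :: "'a set"
    and K :: "'a \<Rightarrow> 'a \<Rightarrow> real"
    and H :: "('a \<Rightarrow> real) set"
    and ip :: "('a \<Rightarrow> real) \<Rightarrow> ('a \<Rightarrow> real) \<Rightarrow> real"
  assumes supported: "f \<in> H \<Longrightarrow> x \<notin> X \<Longrightarrow> f x = 0"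
    and zero_mem: "(\<lambda>x. 0) \<in> H"
    and add_mem: "f \<in> H \<Longrightarrow> g \<in> H \<Longrightarrow> (\<lambda>x. f x + g x) \<in> H"
    and scale_mem: "f \<in> H \<Longrightarrow> (\<lambda>x. c * f x) \<in> H"
    and ip_commute: "f \<in> H \<Longrightarrow> g \<in> H \<Longrightarrow> ip f g = ip g f"
    and ip_add: "f \<in> H \<Longrightarrow> g \<in> H \<Longrightarrow> h \<in> H \<Longrightarrow> ip (\<lambda>x. f x + g x) h = ip f h + ip g h"
    and ip_scale: "f \<in> H \<Longrightarrow> h \<in> H \<Longrightarrow> ip (\<lambda>x. c * f x) h = c * ip f h"
    and ip_nonneg: "f \<in> H \<Longrightarrow> 0 \<le> ip f f"
    and ip_definite: "f \<in> H \<Longrightarrow> ip f f = 0 \<Longrightarrow> f = (\<lambda>x. 0)"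
    and complete: "Metric_space.mcomplete H (\<lambda>f g. fun_norm ip (\<lambda>x. f x - g x))"
    and section_mem: "x \<in> X \<Longrightarrow> kernel_section X K x \<in> H"
    and reproducing: "f \<in> H \<Longrightarrow> x \<in> X \<Longrightarrow> ip f (kernel_section X K x) = f x"


section \<open>Worst-case error\<close>

text \<open>
  The supremum is taken in the extended reals, so that it is meaningful without a prior proof
  that the set is bounded.
\<close>

definition wor_error ::
  "(real ^ 's) multiset \<Rightarrow> ((real ^ 's) \<Rightarrow> real) set \<Rightarrow> (((real ^ 's) \<Rightarrow> real) \<Rightarrow> real) \<Rightarrow> ereal" where
  "wor_error P V nrm =
     (SUP f\<in>{f \<in> V. nrm f \<le> 1}.
        ereal \<bar>1 / real (size P) * (\<Sum>x\<in>#P. f x) - (LINT x:cbox 0 1|lborel. f x)\<bar>)"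


section \<open>Rank-1 lattice point sets\<close>

definition lattice_points :: "nat \<Rightarrow> nat ^ 's \<Rightarrow> (real ^ 's) multiset" where
  "lattice_points N z =
     image_mset (\<lambda>n. \<chi> j. frac (real n * real (z $ j) / real N)) (mset_set {0..<N})"

definition sym_at :: "'s set \<Rightarrow> real ^ 's \<Rightarrow> real ^ 's" where
  "sym_at u x = (\<chi> j. if j \<in> u then 1 - x $ j else x $ j)"

text \<open>The sum of multisets adds multiplicities, so the result has \<open>2 ^ s * N\<close> points.\<close>

definition sym_lattice_points :: "nat \<Rightarrow> nat ^ 's \<Rightarrow> (real ^ 's) multiset" where
  "sym_lattice_points N z = (\<Sum>u\<in>Pow UNIV. image_mset (sym_at u) (lattice_points N z))"

text \<open>Integer vectors indexed by \<open>u\<close> are the extensional functions on \<open>u\<close>.\<close>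

definition dual_lattice :: "nat \<Rightarrow> nat ^ 's \<Rightarrow> 's set \<Rightarrow> ('s \<Rightarrow> int) set" where
  "dual_lattice N z u =
     {k \<in> u \<rightarrow>\<^sub>E (UNIV - {0}). (\<Sum>j\<in>u. k j * int (z $ j)) mod int N = 0}"


section \<open>Kernels\<close>

text \<open>Bernoulli numbers with \<open>B\<^sub>1 = -1/2\<close>.\<close>

fun bernoulli :: "nat \<Rightarrow> real" where
  "bernoulli 0 = 1"
| "bernoulli (Suc n) = - (\<Sum>k\<le>n. real ((n + 2) choose k) * bernoulli k) / real (n + 2)"

definition bernpoly :: "nat \<Rightarrow> real \<Rightarrow> real" where
  "bernpoly n x = (\<Sum>k\<le>n. real (n choose k) * bernoulli k * x ^ (n - k))"

definition sob_kernel_1 :: "nat \<Rightarrow> real \<Rightarrow> real \<Rightarrow> real" where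
  "sob_kernel_1 \<alpha> x y =
     1 + (\<Sum>\<tau>\<in>{\<tau>. 1 \<le> \<tau> \<and> \<tau> \<le> \<alpha> \<and> (odd \<tau> \<or> \<tau> = \<alpha>)}. bernpoly \<tau> x * bernpoly \<tau> y / (fact \<tau>)\<^sup>2)
       + (-1) ^ (\<alpha> + 1) * bernpoly (2 * \<alpha>) \<bar>x - y\<bar> / fact (2 * \<alpha>)"

definition sob_kernel :: "nat \<Rightarrow> ('s set \<Rightarrow> real) \<Rightarrow> real ^ 's \<Rightarrow> real ^ 's \<Rightarrow> real" where
  "sob_kernel \<alpha> \<gamma> x y =
     1 + (\<Sum>u\<in>{u. u \<noteq> {}}. \<gamma> u * (\<Prod>j\<in>u. -1 + sob_kernel_1 \<alpha> (x $ j) (y $ j)))"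

text \<open>
  The exponential series is real, because the terms for \<open>h\<close> and \<open>-h\<close> are conjugate; \<open>Re\<close> only
  changes its type.
\<close>

definition kor_kernel :: "real \<Rightarrow> ('s set \<Rightarrow> real) \<Rightarrow> real ^ 's \<Rightarrow> real ^ 's \<Rightarrow> real" where
  "kor_kernel \<beta> \<eta> x y =
     1 + (\<Sum>u\<in>{u. u \<noteq> {}}. \<eta> u *
            (\<Prod>j\<in>u. Re (\<Sum>\<^sub>\<infinity>h\<in>UNIV - {0::int}.
               exp (2 * of_real pi * \<i> * of_int h * of_real (x $ j - y $ j))
                 / of_real (\<bar>of_int h\<bar> powr (2 * \<beta>)))))"

definition scaled_weights :: "nat \<Rightarrow> ('s set \<Rightarrow> real) \<Rightarrow> 's set \<Rightarrow> real" where
  "scaled_weights \<alpha> \<gamma> u = \<gamma> u * (3 / (2 ^ (2 * \<alpha> + 1) * pi ^ (2 * \<alpha>))) ^ card u"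

end

theory Submission
  imports Defs
begin

text \<open>
  The squared worst-case error is the mean of the kernel over pairs of points minus 1, because the mean of
  the kernel over a fine midpoint grid tends to 1. Reflecting all coordinates cancels the Bernoulli
  polynomials of odd degree, and the Fourier series of the remaining ones turns each factor of the
  symmetrised kernel into \<open>(C x * C y + E x y) / (2 * pi) ^ (2 * \<alpha>)\<close>, where \<open>C x\<close> sums
  \<open>cos (2 * pi * h * x) / h ^ \<alpha>\<close> over the nonzero integers \<open>h\<close> and \<open>E x y\<close> sums
  \<open>cos (2 * pi * h * x) * cos (2 * pi * h * y) / h ^ (2 * \<alpha>)\<close>. All Fourier coefficients are nonnegative, and
  so are the means of products of cosines over the lattice; hence, coordinate by coordinate, \<open>E\<close>
  contributes at most half as much as the product of the two \<open>C\<close>, which yields the factor \<open>3 / 2\<close>. The mean of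
  \<open>\<Prod>j\<in>u. C (x $ j)\<close> over the lattice is the sum over the dual lattice, which also determines the
  error in the Korobov space. The second inequality is then
  \<open>(\<Sum>u. (a u)\<^sup>2) \<le> (\<Sum>u. a u)\<^sup>2\<close> for \<open>a u \<ge> 0\<close>.
\<close>

section \<open>Means and reproducing kernels\<close>

text \<open>Elements of \<open>H\<close> come without any regularity, and no element of
  \<open>H\<close> that represents the integral is at hand. Integration is therefore approached
  through grids: their means are represented by finite combinations of kernel sections, and the
  error is a limit of distances between such representers. Midpoints are chosen because the grid is
  invariant under reflection, which annihilates Bernoulli polynomials of odd degree exactly, and
  because it integrates low frequencies exactly.

  The comparison of \<open>E\<close> with the product of the \<open>C\<close> cannot hold point by
  point: \<open>E x x\<close> stays positive where \<open>C x\<close> vanishes. It holds for means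
  only, and expanding one coordinate multiplies the remaining factors by cosines. The induction over
  the coordinates therefore carries a weight from a class that is closed under multiplication by
  cosines. The pair \<open>h\<close>, \<open>-h\<close> has coefficient 2 in \<open>C\<close>, hence
  4 on the diagonal of the product of the two \<open>C\<close>, but only 2 in \<open>E\<close>; this
  is the origin of the half, and \<open>3 / 2 = 1 + 1 / 2\<close>.\<close>

definition mset_mean :: "'a multiset \<Rightarrow> ('a \<Rightarrow> real) \<Rightarrow> real" where
  "mset_mean P f = 1 / real (size P) * (\<Sum>x\<in>#P. f x)"

lemma mset_mean_const: "P \<noteq> {#} \<Longrightarrow> mset_mean P (\<lambda>x. c) = c"
  by (simp add: mset_mean_def)

lemma mset_mean_add: "mset_mean P (\<lambda>x. f x + g x) = mset_mean P f + mset_mean P g"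
  by (simp add: mset_mean_def sum_mset.distrib distrib_left)

lemma mset_mean_cmult: "mset_mean P (\<lambda>x. c * f x) = c * mset_mean P f"
  by (simp add: mset_mean_def sum_mset_distrib_left mult.left_commute)

lemma mset_mean_diff: "mset_mean P (\<lambda>x. f x - g x) = mset_mean P f - mset_mean P g"
  using mset_mean_add[of P f "\<lambda>x. -1 * g x"] mset_mean_cmult[of P "-1" g] by simp

lemma mset_mean_sum: "mset_mean P (\<lambda>x. \<Sum>i\<in>A. f i x) = (\<Sum>i\<in>A. mset_mean P (f i))"
proof (induction A rule: infinite_finite_induct)
  case (insert i A)
  then show ?case by (simp add: mset_mean_add)
qed (simp_all add: mset_mean_def)

lemma mset_mean_cong: "(\<And>x. x \<in># P \<Longrightarrow> f x = g x) \<Longrightarrow> mset_mean P f = mset_mean P g"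
  unfolding mset_mean_def by (metis image_mset_cong)

lemma mset_mean_bound:
  assumes "P \<noteq> {#}" "\<And>x. x \<in># P \<Longrightarrow> \<bar>f x - c\<bar> \<le> e"
  shows "\<bar>mset_mean P f - c\<bar> \<le> e"
proof -
  have "\<bar>\<Sum>x\<in>#Q. f x - c\<bar> \<le> real (size Q) * e" if "\<And>x. x \<in># Q \<Longrightarrow> \<bar>f x - c\<bar> \<le> e" for Q
    using that
  proof (induction Q)
    case (add x Q)
    have "\<bar>\<Sum>x\<in>#Q. f x - c\<bar> \<le> real (size Q) * e" "\<bar>f x - c\<bar> \<le> e"
      using add by auto
    then show ?case by (simp add: algebra_simps)
  qed simp
  from this[OF assms(2)] have "\<bar>\<Sum>x\<in>#P. f x - c\<bar> \<le> real (size P) * e" by blast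
  then have "\<bar>mset_mean P (\<lambda>x. f x - c)\<bar> \<le> e"
    using assms(1) by (simp add: mset_mean_def abs_mult divide_le_eq mult.commute nonempty_has_size)
  then show ?thesis
    by (simp add: mset_mean_diff mset_mean_const[OF assms(1)])
qed

lemma mset_mean_image_mset: "mset_mean (image_mset h P) f = mset_mean P (\<lambda>x. f (h x))"
  by (simp add: mset_mean_def multiset.map_comp comp_def)

lemma mset_mean_mset_set: "mset_mean (mset_set A) f = (\<Sum>x\<in>A. f x) / real (card A)"
  by (simp add: mset_mean_def sum_unfold_sum_mset)

section \<open>Representers of finite means\<close>

context rkhs
begin

lemma diff_mem: "f \<in> H \<Longrightarrow> g \<in> H \<Longrightarrow> (\<lambda>x. f x - g x) \<in> H"
  using add_mem[of f "\<lambda>x. -1 * g x"] scale_mem[of g "-1"] by simp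

lemma ip_diff_left:
  "f \<in> H \<Longrightarrow> g \<in> H \<Longrightarrow> h \<in> H \<Longrightarrow> ip (\<lambda>x. f x - g x) h = ip f h - ip g h"
  using ip_add[of f "\<lambda>x. -1 * g x" h] scale_mem[of g "-1"] ip_scale[of g h "-1"] by simp

lemma ip_diff_right:
  "f \<in> H \<Longrightarrow> g \<in> H \<Longrightarrow> h \<in> H \<Longrightarrow> ip h (\<lambda>x. f x - g x) = ip h f - ip h g"
  by (metis (no_types, lifting) diff_mem ip_commute ip_diff_left)

lemma ip_scale_right: "f \<in> H \<Longrightarrow> h \<in> H \<Longrightarrow> ip h (\<lambda>x. c * f x) = c * ip h f"
  by (metis (no_types, lifting) scale_mem ip_commute ip_scale)

lemma ip_zero_right: "f \<in> H \<Longrightarrow> ip f (\<lambda>x. 0) = 0"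
  using ip_scale_right[OF zero_mem, of f 0] by simp

lemma Cauchy_Schwarz_ip:
  assumes f: "f \<in> H" and g: "g \<in> H"
  shows "(ip f g)\<^sup>2 \<le> ip f f * ip g g"
proof (cases "ip g g = 0")
  case True
  then have "g = (\<lambda>x. 0)" using ip_definite g by blast
  then show ?thesis using f True by (simp add: ip_zero_right)
next
  case False
  then have pos: "ip g g > 0" using ip_nonneg[OF g] by simp
  define t where "t = ip f g / ip g g"
  have tg: "(\<lambda>x. t * g x) \<in> H" using scale_mem g by blast
  have "0 \<le> ip (\<lambda>x. f x - t * g x) (\<lambda>x. f x - t * g x)"
    by (intro ip_nonneg diff_mem f tg)
  also have "\<dots> = ip f f - 2 * t * ip f g + t\<^sup>2 * ip g g"
    using f g tg diff_mem[OF f tg] ip_commute[OF f g]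
    by (simp add: ip_diff_left ip_diff_right ip_scale ip_scale_right power2_eq_square
        algebra_simps)
  also have "\<dots> = ip f f - (ip f g)\<^sup>2 / ip g g"
    using pos by (simp add: t_def power2_eq_square field_simps)
  finally show ?thesis using pos by (simp add: field_simps)
qed

lemma abs_ip_le: "f \<in> H \<Longrightarrow> g \<in> H \<Longrightarrow> \<bar>ip f g\<bar> \<le> fun_norm ip f * fun_norm ip g"
  unfolding fun_norm_def using Cauchy_Schwarz_ip[of f g]
  by (metis real_sqrt_mult real_sqrt_abs real_sqrt_le_mono)

text \<open>The Riesz representer of the functional \<open>mset_mean P\<close> on \<open>H\<close>,
  also known as the kernel mean embedding of \<open>P\<close>.\<close>

definition mean_section :: "'a multiset \<Rightarrow> ('a \<Rightarrow> real)" where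
  "mean_section P = (\<lambda>y. mset_mean P (\<lambda>x. kernel_section X K x y))"

lemma mean_section:
  assumes "set_mset P \<subseteq> X"
  shows "mean_section P \<in> H" "f \<in> H \<Longrightarrow> ip f (mean_section P) = mset_mean P f"
proof -
  have *: "(\<lambda>y. \<Sum>x\<in>#P. kernel_section X K x y) \<in> H \<and>
    (\<forall>f\<in>H. ip f (\<lambda>y. \<Sum>x\<in>#P. kernel_section X K x y) = (\<Sum>x\<in>#P. f x))"
    using assms
  proof (induction P)
    case empty
    then show ?case by (simp add: zero_mem ip_zero_right)
  next
    case (add x P)
    have x: "kernel_section X K x \<in> H" using add by (auto intro: section_mem)
    have "ip f (\<lambda>y. kernel_section X K x y + (\<Sum>x\<in>#P. kernel_section X K x y)) =
      f x + (\<Sum>x\<in>#P. f x)" if f: "f \<in> H" for f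
    proof -
      have "ip f (\<lambda>y. kernel_section X K x y + (\<Sum>x\<in>#P. kernel_section X K x y))
        = ip (kernel_section X K x) f + ip (\<lambda>y. \<Sum>x\<in>#P. kernel_section X K x y) f"
        using add f x ip_commute[OF f add_mem[OF x]] by (simp add: ip_add)
      also have "\<dots> = f x + (\<Sum>x\<in>#P. f x)"
        using add f x reproducing[OF f] by (simp add: ip_commute[OF _ f])
      finally show ?thesis .
    qed
    then show ?case using add add_mem[OF x] by simp
  qed
  show "mean_section P \<in> H"
    using * unfolding mean_section_def mset_mean_def by (intro scale_mem) blast
  show "ip f (mean_section P) = mset_mean P f" if "f \<in> H"
    using * that unfolding mean_section_def mset_mean_def
    by (subst ip_scale_right) auto
qed

lemma mean_section_apply:
  "y \<in> X \<Longrightarrow> mean_section P y = mset_mean P (K y)"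
  by (simp add: mean_section_def kernel_section_def)

lemma mset_mean_mean_section:
  "set_mset P \<subseteq> X \<Longrightarrow> mset_mean P (mean_section Q) = mset_mean P (\<lambda>x. mset_mean Q (K x))"
  by (intro mset_mean_cong) (auto simp: mean_section_apply)

text \<open>The squared distance of two representers in terms of the kernel alone. With a fine grid
  as \<open>Q\<close> it becomes the squared worst-case error of \<open>P\<close>.\<close>

lemma fun_norm_mean_section_diff:
  assumes "set_mset P \<subseteq> X" "set_mset Q \<subseteq> X"
  shows "(fun_norm ip (\<lambda>x. mean_section P x - mean_section Q x))\<^sup>2 =
    mset_mean P (\<lambda>x. mset_mean P (K x)) - 2 * mset_mean P (\<lambda>x. mset_mean Q (K x))
      + mset_mean Q (\<lambda>x. mset_mean Q (K x))"
proof -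
  note PQ = mean_section[OF assms(1)] mean_section[OF assms(2)]
  have "(fun_norm ip (\<lambda>x. mean_section P x - mean_section Q x))\<^sup>2 =
     ip (\<lambda>x. mean_section P x - mean_section Q x) (\<lambda>x. mean_section P x - mean_section Q x)"
    unfolding fun_norm_def using diff_mem PQ ip_nonneg by simp
  also have "\<dots> = ip (mean_section P) (mean_section P) - 2 * ip (mean_section Q) (mean_section P)
      + ip (mean_section Q) (mean_section Q)"
    using PQ(1,3) diff_mem[OF PQ(1,3)] ip_commute[OF PQ(1,3)]
    by (simp add: ip_diff_left ip_diff_right)
  finally show ?thesis
    using assms PQ by (simp add: mset_mean_mean_section)
qed

text \<open>Cauchy-Schwarz against the difference of two kernel sections; the square root is the
  norm of that difference. A continuous kernel thereby makes every element of \<open>H\<close>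
  continuous.\<close>

lemma abs_diff_le_fun_norm:
  assumes f: "f \<in> H" and x: "x \<in> X" and y: "y \<in> X"
  shows "\<bar>f x - f y\<bar> \<le> fun_norm ip f * sqrt (K x x - K x y - K y x + K y y)"
proof -
  let ?g = "\<lambda>t. kernel_section X K x t - kernel_section X K y t"
  note s = section_mem[OF x] section_mem[OF y]
  have "ip f ?g = f x - f y"
    using f x y s by (simp add: ip_diff_right reproducing)
  moreover have "ip ?g ?g = K x x - K x y - K y x + K y y"
    using f x y s diff_mem[OF s]
    by (simp add: ip_diff_right reproducing) (simp add: kernel_section_def)
  ultimately show ?thesis
    using abs_ip_le[OF f diff_mem[OF s]] by (simp add: fun_norm_def)
qed

end

text \<open>Supplies the regularity that membership in \<open>H\<close> alone does not state and
  that convergence of midpoint sums to the integral rests on.\<close>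

lemma rkhs_continuous_on:
  fixes X :: "'a::topological_space set"
  assumes "rkhs X K H ip" and cont: "continuous_on (X \<times> X) (\<lambda>p. K (fst p) (snd p))"
    and f: "f \<in> H"
  shows "continuous_on X f"
  unfolding continuous_on_def
proof
  interpret rkhs X K H ip by fact
  fix a assume a: "a \<in> X"
  let ?d = "\<lambda>x. K x x - K x a - K a x + K a a"
  have c: "continuous_on X (\<lambda>x. K (p x) (q x))"
    if "continuous_on X p" "continuous_on X q" "p ` X \<subseteq> X" "q ` X \<subseteq> X" for p q
    using continuous_on_compose2[OF cont, of X "\<lambda>x. (p x, q x)"] that
    by (auto intro: continuous_on_Pair)
  have "continuous_on X ?d"
    by (intro continuous_intros c) (use a in auto)
  then have "continuous_on X (\<lambda>x. fun_norm ip f * sqrt (?d x))"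
    by (intro continuous_on_mult continuous_on_const continuous_on_real_sqrt)
  then have *: "((\<lambda>x. fun_norm ip f * sqrt (?d x)) \<longlongrightarrow> 0) (at a within X)"
    unfolding continuous_on_def by (drule_tac bspec[OF _ a]) simp
  have "((\<lambda>x. f x - f a) \<longlongrightarrow> 0) (at a within X)"
    by (rule Lim_null_comparison[OF _ *])
      (use abs_diff_le_fun_norm[OF f _ a] in \<open>auto simp: eventually_at_filter\<close>)
  then show "(f \<longlongrightarrow> f a) (at a within X)" by (simp add: LIM_zero_iff)
qed

section \<open>Midpoint sums and the integral over the cube\<close>

definition midpoint_grid :: "nat \<Rightarrow> (real ^ 's) multiset" where
  "midpoint_grid M =
     image_mset (\<lambda>m. \<chi> j. (2 * real (m j) + 1) / (2 * real M)) (mset_set (PiE UNIV (\<lambda>_. {..<M})))"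

lemma card_grid_index: "card (PiE (UNIV :: 's::finite set) (\<lambda>_. {..<M::nat})) = M ^ CARD('s)"
  by (simp add: card_PiE)

lemma finite_grid_index: "finite (PiE (UNIV :: 's::finite set) (\<lambda>_. {..<M::nat}))"
  by (simp add: finite_PiE)

lemma mset_mean_midpoint_grid:
  "mset_mean (midpoint_grid M :: (real ^ 's) multiset) f =
    (\<Sum>m\<in>PiE UNIV (\<lambda>_. {..<M}). f (\<chi> j. (2 * real (m j) + 1) / (2 * real M))) / real M ^ CARD('s)"
  by (simp add: midpoint_grid_def mset_mean_image_mset mset_mean_mset_set card_grid_index)

lemma midpoint_grid_nonempty: "M > 0 \<Longrightarrow> (midpoint_grid M :: (real ^ 's) multiset) \<noteq> {#}"
  by (auto simp: midpoint_grid_def mset_set_empty_iff finite_grid_index PiE_eq_empty_iff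
      simp flip: lessThan_0)

lemma set_midpoint_grid:
  "set_mset (midpoint_grid M :: (real ^ 's) multiset) \<subseteq> cbox 0 1"
proof
  fix x :: "real ^ 's" assume "x \<in># midpoint_grid M"
  then have "x \<in> (\<lambda>m. \<chi> j. (2 * real (m j) + 1) / (2 * real M)) ` PiE UNIV (\<lambda>_. {..<M})"
    by (simp add: midpoint_grid_def finite_grid_index)
  then obtain m :: "'s \<Rightarrow> nat" where "m \<in> PiE UNIV (\<lambda>_. {..<M})"
    and x: "x = (\<chi> j. (2 * real (m j) + 1) / (2 * real M))"
    by blast
  then have m: "m j < M" for j by auto
  have "2 * real (m j) + 1 \<le> 2 * real M" "real M > 0" for j
    using m[of j] by linarith+
  then show "x \<in> cbox 0 1"
    by (simp add: x mem_box_cart)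
qed

text \<open>The grid mean is the integral of the step function \<open>g\<close> that takes on each
  cell the value of \<open>f\<close> at the centre. Uniform continuity keeps \<open>g\<close> within
  \<open>e\<close> of \<open>f\<close> almost everywhere on the cube.\<close>

lemma midpoint_grid_tendsto_integral:
  fixes f :: "real ^ 's \<Rightarrow> real"
  assumes f: "continuous_on (cbox 0 1) f"
  shows "(\<lambda>M. mset_mean (midpoint_grid M) f) \<longlonglongrightarrow> (LINT x:cbox 0 1|lborel. f x)"
proof (rule LIMSEQ_I)
  fix r :: real assume "r > 0"
  define e where "e = r / 2"
  have e: "e > 0" using \<open>r > 0\<close> by (simp add: e_def)
  have "uniformly_continuous_on (cbox 0 1) f"
    by (intro compact_uniformly_continuous f compact_cbox)
  then obtain d where d: "d > 0"
    "\<And>x y. x \<in> cbox 0 1 \<Longrightarrow> y \<in> cbox 0 1 \<Longrightarrow> dist y x < d \<Longrightarrow> dist (f y) (f x) < e"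
    using e unfolding uniformly_continuous_on_def by metis
  \<comment> \<open>In each coordinate a point is within \<open>1 / M\<close> of the centre of its
    cell, so the l1 norm bounds the distance by \<open>CARD('s) / M\<close>, which has to be below
    \<open>d\<close>.\<close>
  obtain M0 :: nat where M0: "real CARD('s) / d < real M0" using reals_Archimedean2 by blast
  show "\<exists>no. \<forall>M\<ge>no. norm (mset_mean (midpoint_grid M) f - (LINT x:cbox 0 1|lborel. f x)) < r"
  proof (intro exI allI impI)
    fix M assume "M \<ge> M0"
    then have MC: "real CARD('s) / d < real M" using M0 by simp
    then have M: "real M > 0" using d(1) by (smt (verit) divide_nonneg_pos of_nat_0_le_iff)
    define I where "I = PiE (UNIV :: 's set) (\<lambda>_. {..<M})"
    have finI: "finite I" by (simp add: I_def finite_grid_index)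
    define c :: "('s \<Rightarrow> nat) \<Rightarrow> real ^ 's" where "c m = (\<chi> j. (2 * real (m j) + 1) / (2 * real M))" for m
    \<comment> \<open>The floor makes the cells half-open and hence disjoint, so at most one summand
      of \<open>g\<close> is nonzero at any point.\<close>
    define cell :: "('s \<Rightarrow> nat) \<Rightarrow> (real ^ 's) set" where
      "cell m = {x. \<forall>j. \<lfloor>real M * x $ j\<rfloor> = int (m j)}" for m
    have c: "c m \<in> cbox 0 1" if "m \<in> I" for m
      using set_midpoint_grid[of M] that finI unfolding midpoint_grid_def c_def I_def by auto
    have [measurable]: "cell m \<in> sets borel" for m
      unfolding cell_def by measurable
    define a b :: "('s \<Rightarrow> nat) \<Rightarrow> real ^ 's" where
      "a m = (\<chi> j. real (m j) / real M)" and "b m = (\<chi> j. (real (m j) + 1) / real M)" for m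
    have cell_iff: "x \<in> cell m \<longleftrightarrow> (\<forall>j. a m $ j \<le> x $ j \<and> x $ j < b m $ j)" for x m
      unfolding cell_def a_def b_def using M by (simp add: floor_eq_iff field_simps)
    have sub: "box (a m) (b m) \<subseteq> cell m" "cell m \<subseteq> cbox (a m) (b m)" for m
      by (auto simp: cell_iff mem_box_cart less_imp_le)
    have ab: "a m \<le> b m" for m
      using M by (simp add: a_def b_def less_eq_vec_def divide_right_mono)
    have cbox_meas: "measure lborel (cbox (a m) (b m)) = 1 / real M ^ CARD('s)" for m
    proof -
      have "cbox (a m) (b m) \<noteq> {}" using ab[of m] by (simp add: less_eq_vec_def interval_ne_empty_cart)
      then have "measure lborel (cbox (a m) (b m)) = (\<Prod>j\<in>UNIV. b m $ j - a m $ j)"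
        using content_cbox_cart by blast
      also have "\<dots> = (\<Prod>j\<in>(UNIV :: 's set). 1 / real M)"
        by (simp add: a_def b_def diff_divide_distrib [symmetric])
      finally show ?thesis by (simp add: power_one_over)
    qed
    \<comment> \<open>A cell lies between an open and a closed box of equal volume.\<close>
    have meas: "emeasure lborel (cell m) = ennreal (1 / real M ^ CARD('s))" for m
    proof (rule antisym)
      have eb: "emeasure lborel (box (a m) (b m)) = ennreal (1 / real M ^ CARD('s))"
        using cbox_meas[of m] by (simp add: measure_lborel_cbox_eq emeasure_lborel_box_eq split: if_splits)
      have ec: "emeasure lborel (cbox (a m) (b m)) = ennreal (1 / real M ^ CARD('s))"
        using cbox_meas[of m] by (simp add: measure_lborel_cbox_eq emeasure_lborel_cbox_eq split: if_splits)
      show "emeasure lborel (cell m) \<le> ennreal (1 / real M ^ CARD('s))"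
        unfolding ec[of, symmetric] by (intro emeasure_mono sub) auto
      show "ennreal (1 / real M ^ CARD('s)) \<le> emeasure lborel (cell m)"
        unfolding eb[of, symmetric] by (intro emeasure_mono sub) auto
    qed
    define g where "g x = (\<Sum>m\<in>I. indicator (cell m) x *\<^sub>R f (c m))" for x
    have int_cell: "integrable lborel (\<lambda>x. indicator (cell m) x *\<^sub>R f (c m))" for m
      by (intro integrable_scaleR_left integrable_real_indicator) (auto simp: meas)
    have int_g: "integrable lborel g"
      unfolding g_def by (intro Bochner_Integration.integrable_sum int_cell)
    have "integral\<^sup>L lborel g = (\<Sum>m\<in>I. measure lborel (cell m) *\<^sub>R f (c m))"
      unfolding g_def by (subst Bochner_Integration.integral_sum[OF int_cell]) (simp add: meas)
    then have Ig: "integral\<^sup>L lborel g = mset_mean (midpoint_grid M) f"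
      by (simp add: mset_mean_midpoint_grid measure_def meas sum_divide_distrib c_def I_def)
    have int_f: "set_integrable lborel (cbox 0 1) f"
      unfolding set_integrable_def by (intro borel_integrable_compact f compact_cbox)
    have g_val: "g x = f (c m)" if "x \<in> cell m" "m \<in> I" for x m
    proof -
      have "x \<in> cell m' \<longleftrightarrow> m' = m" for m'
        using that(1) by (auto simp: cell_def fun_eq_iff)
      then have "indicator (cell m') x *\<^sub>R f (c m') = (if m' = m then f (c m) else 0)" for m'
        by (simp add: indicator_def)
      then show ?thesis using that finI by (simp add: g_def)
    qed
    \<comment> \<open>Points of the cube with a coordinate equal to 1 lie in no cell with index in
      \<open>I\<close>; the bound is claimed only off the boundary, which is a null set.\<close>
    have bound: "norm (indicator (cbox 0 1) x *\<^sub>R f x - g x) \<le> indicator (cbox 0 1) x * e"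
      if x: "x \<notin> cbox 0 1 - box 0 1" for x
    proof (cases "x \<in> cbox 0 1")
      case False
      have "x \<notin> cell m" if m: "m \<in> I" for m
      proof
        assume "x \<in> cell m"
        then have x: "a m $ j \<le> x $ j" "x $ j < b m $ j" for j by (auto simp: cell_iff)
        have "real (m j) + 1 \<le> real M" for j using m by (auto simp: I_def PiE_iff) (metis Suc_leI of_nat_Suc of_nat_mono add.commute)
        then have "0 \<le> a m $ j" "b m $ j \<le> 1" for j
          using M by (auto simp: a_def b_def)
        then have "x \<in> cbox 0 1" using x by (auto simp: mem_box_cart) (meson order.trans less_imp_le)+
        with False show False by blast
      qed
      then have "g x = 0" by (simp add: g_def)
      with False show ?thesis by simp
    next
      case True
      then have box: "x \<in> box 0 1" using x by blast
      define m where "m j = nat \<lfloor>real M * x $ j\<rfloor>" for j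
      have xj: "0 < x $ j" "x $ j < 1" for j using box by (auto simp: mem_box_cart)
      have "x \<in> cell m" using xj M by (auto simp: cell_def m_def less_imp_le)
      moreover have mI: "m \<in> I"
      proof -
        have "real M * x $ j < real M" for j using xj M by simp
        then have "\<lfloor>real M * x $ j\<rfloor> < int M" for j by (simp add: floor_less_iff)
        then have "m j < M" for j
          unfolding m_def using M by (metis nat_less_iff nat_int zero_less_nat_eq nat_mono_iff of_nat_0_less_iff)
        then show ?thesis by (auto simp: I_def)
      qed
      ultimately have gx: "g x = f (c m)" and xc: "\<And>j. a m $ j \<le> x $ j \<and> x $ j < b m $ j"
        using g_val cell_iff by blast+
      have "\<bar>x $ j - c m $ j\<bar> \<le> 1 / real M" for j
        using xc[of j] M by (auto simp: a_def b_def c_def field_simps abs_le_iff)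
      then have "(\<Sum>j\<in>UNIV. \<bar>(x - c m) $ j\<bar>) \<le> (\<Sum>j\<in>(UNIV :: 's set). 1 / real M)"
        by (intro sum_mono) simp
      then have "norm (x - c m) \<le> real CARD('s) / real M"
        using norm_le_l1_cart[of "x - c m"] by simp
      also have "\<dots> < d" using MC M d(1) by (simp add: field_simps)
      finally have "dist (f x) (f (c m)) < e"
        using d(2)[OF c[OF mI] True] by (simp add: dist_norm)
      then show ?thesis using True gx by (simp add: dist_norm)
    qed
    have null: "AE x in lborel. x \<notin> cbox 0 1 - box (0 :: real ^ 's) 1"
      by (rule AE_not_in[OF null_sets_cbox_Diff_box])
    have m1: "measure lborel (cbox (0 :: real ^ 's) 1) = 1"
      by (subst content_cbox_cart) (auto simp: interval_ne_empty_cart)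
    have "norm (integral\<^sup>L lborel (\<lambda>x. indicator (cbox 0 1) x *\<^sub>R f x - g x))
      \<le> integral\<^sup>L lborel (\<lambda>x. norm (indicator (cbox 0 1) x *\<^sub>R f x - g x))"
      by (rule integral_norm_bound)
    also have "\<dots> \<le> integral\<^sup>L lborel (\<lambda>x :: real ^ 's. indicator (cbox 0 1) x * e)"
      using int_f int_g null bound unfolding set_integrable_def
      by (intro integral_mono_AE integrable_norm Bochner_Integration.integrable_diff
         integrable_mult_left integrable_real_indicator) (auto simp: emeasure_lborel_cbox_eq)
    also have "\<dots> = e" using m1 by simp
    also have "integral\<^sup>L lborel (\<lambda>x. indicator (cbox 0 1) x *\<^sub>R f x - g x) =
        (LINT x:cbox 0 1|lborel. f x) - mset_mean (midpoint_grid M) f"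
      using int_f int_g Ig by (simp add: set_integrable_def set_lebesgue_integral_def)
    finally show "norm (mset_mean (midpoint_grid M) f - (LINT x:cbox 0 1|lborel. f x)) < r"
      using \<open>r > 0\<close> by (simp add: e_def abs_minus_commute)
  qed
qed

section \<open>The worst-case error as a mean of the kernel\<close>

lemma (in rkhs) mset_mean_mean_section_commute:
  assumes "set_mset P \<subseteq> X" "set_mset Q \<subseteq> X"
  shows "mset_mean P (mean_section Q) = mset_mean Q (mean_section P)"
  using mean_section[OF assms(1)] mean_section[OF assms(2)] ip_commute by metis

text \<open>The difference of the means over \<open>P\<close> and over the grid is represented by
  \<open>f M\<close>, whose squared norm \<open>D M\<close> tends to \<open>E\<close>.
  Cauchy-Schwarz bounds the error on the unit ball by \<open>sqrt (D M)\<close> for each grid and so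
  by \<open>sqrt E\<close> in the limit. The normalised \<open>f M\<close> attain this bound
  asymptotically.\<close>

theorem rkhs_wor_error_squared:
  fixes K :: "real ^ 's \<Rightarrow> real ^ 's \<Rightarrow> real"
  assumes "rkhs (cbox 0 1) K H ip"
    and cont: "continuous_on (cbox 0 1 \<times> cbox 0 1) (\<lambda>p. K (fst p) (snd p))"
    and lim: "uniform_limit (cbox 0 1) (\<lambda>M x. mset_mean (midpoint_grid M) (K x)) (\<lambda>x. 1) sequentially"
    and P: "P \<noteq> {#}" "set_mset P \<subseteq> cbox 0 1"
  shows "(wor_error P H (fun_norm ip))\<^sup>2 = ereal (mset_mean P (\<lambda>x. mset_mean P (K x)) - 1)"
proof -
  interpret rkhs "cbox 0 1" K H ip by fact
  define G :: "nat \<Rightarrow> (real ^ 's) multiset" where "G = midpoint_grid"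
  have G: "set_mset (G M) \<subseteq> cbox 0 1" for M
    by (simp add: G_def set_midpoint_grid)
  have G_mean: "(\<lambda>M. mset_mean (G M) f) \<longlonglongrightarrow> (LINT x:cbox 0 1|lborel. f x)" if "f \<in> H" for f
    unfolding G_def using that
    by (intro midpoint_grid_tendsto_integral rkhs_continuous_on[OF assms(1) cont])
  \<comment> \<open>\<open>Q\<close> may move with \<open>M\<close>: besides fixed point sets the
    grid itself is inserted, and there uniformity of the limit is essential. The grid is empty for
    \<open>M = 0\<close>, hence the restriction to \<open>M > 0\<close>.\<close>
  have QG: "(\<lambda>M. mset_mean (Q M) (\<lambda>x. mset_mean (G M) (K x))) \<longlonglongrightarrow> 1"
    if Q: "\<And>M. M > 0 \<Longrightarrow> Q M \<noteq> {#}" "\<And>M. set_mset (Q M) \<subseteq> cbox 0 1" for Q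
  proof (rule tendstoI)
    fix e :: real assume "e > 0"
    then have "\<forall>\<^sub>F M in sequentially. \<forall>x\<in>cbox 0 1. dist (mset_mean (G M) (K x)) 1 < e / 2"
      using uniform_limitD[OF lim, of "e / 2"] by (simp add: G_def)
    then show "\<forall>\<^sub>F M in sequentially. dist (mset_mean (Q M) (\<lambda>x. mset_mean (G M) (K x))) 1 < e"
      using eventually_gt_at_top[of 0]
    proof eventually_elim
      case (elim M)
      have "\<bar>mset_mean (Q M) (\<lambda>x. mset_mean (G M) (K x)) - 1\<bar> \<le> e / 2"
        by (rule mset_mean_bound) (use elim Q in \<open>fastforce simp: dist_real_def\<close>)+
      then show ?case using \<open>e > 0\<close> by (simp add: dist_real_def)
    qed
  qed
  define E where "E = mset_mean P (\<lambda>x. mset_mean P (K x)) - 1"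
  define f where "f M = (\<lambda>x. mean_section P x - mean_section (G M) x)" for M
  define D where "D M = (fun_norm ip (f M))\<^sup>2" for M
  have f_mem: "f M \<in> H" for M
    unfolding f_def by (intro diff_mem mean_section P G)
  have ip_f: "ip g (f M) = mset_mean P g - mset_mean (G M) g" if "g \<in> H" for g M
    unfolding f_def using that P G by (simp add: ip_diff_right mean_section)
  have norm_f: "fun_norm ip (f M) = sqrt (D M)" for M
    by (simp add: D_def fun_norm_def ip_nonneg f_mem)
  have PG: "(\<lambda>M. mset_mean P (\<lambda>x. mset_mean (G M) (K x))) \<longlonglongrightarrow> 1"
    by (rule QG) (use P in auto)
  have GG: "(\<lambda>M. mset_mean (G M) (\<lambda>x. mset_mean (G M) (K x))) \<longlonglongrightarrow> 1"
    by (rule QG) (use G midpoint_grid_nonempty in \<open>auto simp: G_def\<close>)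
  have "D = (\<lambda>M. mset_mean P (\<lambda>x. mset_mean P (K x)) - 2 * mset_mean P (\<lambda>x. mset_mean (G M) (K x))
      + mset_mean (G M) (\<lambda>x. mset_mean (G M) (K x)))"
    using P G by (simp add: D_def f_def fun_norm_mean_section_diff fun_eq_iff)
  moreover have "\<dots> \<longlonglongrightarrow> mset_mean P (\<lambda>x. mset_mean P (K x)) - 2 * 1 + 1"
    by (intro tendsto_intros PG GG)
  ultimately have "D \<longlonglongrightarrow> mset_mean P (\<lambda>x. mset_mean P (K x)) - 2 * 1 + 1"
    by simp
  then have D: "D \<longlonglongrightarrow> E" by (simp add: E_def)
  have E: "E \<ge> 0" by (rule LIMSEQ_le_const[OF D]) (simp add: D_def)
  have "wor_error P H (fun_norm ip) \<le> ereal (sqrt E)"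
    unfolding wor_error_def
  proof (rule SUP_least)
    fix g assume "g \<in> {g \<in> H. fun_norm ip g \<le> 1}"
    then have g: "g \<in> H" "fun_norm ip g \<le> 1" by auto
    have "\<bar>mset_mean P g - mset_mean (G M) g\<bar> \<le> sqrt (D M)" for M
    proof -
      have "\<bar>mset_mean P g - mset_mean (G M) g\<bar> \<le> fun_norm ip g * sqrt (D M)"
        using abs_ip_le[OF g(1) f_mem] by (simp add: ip_f g norm_f)
      also have "\<dots> \<le> 1 * sqrt (D M)"
        by (intro mult_right_mono g) (simp add: D_def)
      finally show ?thesis by simp
    qed
    moreover have "(\<lambda>M. \<bar>mset_mean P g - mset_mean (G M) g\<bar>) \<longlonglongrightarrow>
        \<bar>mset_mean P g - (LINT x:cbox 0 1|lborel. g x)\<bar>"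
      by (intro tendsto_intros G_mean g)
    ultimately have "\<bar>mset_mean P g - (LINT x:cbox 0 1|lborel. g x)\<bar> \<le> sqrt E"
      using tendsto_real_sqrt[OF D] by (blast intro: LIMSEQ_le)
    then show "ereal \<bar>1 / real (size P) * (\<Sum>x\<in>#P. g x) - (LINT x:cbox 0 1|lborel. g x)\<bar> \<le> ereal (sqrt E)"
      by (simp add: mset_mean_def)
  qed
  moreover have "ereal (sqrt E) \<le> wor_error P H (fun_norm ip)"
  \<comment> \<open>Normalising by \<open>sqrt (D M)\<close> makes sense only if
    \<open>E > 0\<close>; otherwise the zero function is enough.\<close>
  proof (cases "E = 0")
    case True
    have "0 \<le> wor_error P H (fun_norm ip)"
      unfolding wor_error_def
      by (rule SUP_upper2[of "\<lambda>x. 0"])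
        (auto simp: zero_mem fun_norm_def ip_zero_right)
    then show ?thesis using True by (simp add: zero_ereal_def)
  next
    case False
    then have E: "E > 0" using E by simp
    \<comment> \<open>Both representers have integral 1, so their difference has integral 0. The
      integral is computed on a second grid, whose index \<open>L\<close> grows while
      \<open>M\<close> stays fixed.\<close>
    have int_f: "(LINT x:cbox 0 1|lborel. c * f M x) = 0" if "M > 0" for M c
    proof -
      have sec: "(\<lambda>L. mset_mean (G L) (mean_section Q)) \<longlonglongrightarrow> 1"
        if Q: "Q \<noteq> {#}" "set_mset Q \<subseteq> cbox 0 1" for Q
        using QG[of "\<lambda>_. Q"] Q
        by (simp add: mset_mean_mean_section_commute[OF G Q(2)] mset_mean_mean_section[OF Q(2)])
      have "(\<lambda>L. c * (mset_mean (G L) (mean_section P) - mset_mean (G L) (mean_section (G M))))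
          \<longlonglongrightarrow> c * (1 - 1)"
        by (intro tendsto_intros sec) (use that P G midpoint_grid_nonempty in \<open>auto simp: G_def\<close>)
      then have "(\<lambda>L. mset_mean (G L) (\<lambda>x. c * f M x)) \<longlonglongrightarrow> 0"
        by (simp add: mset_mean_cmult f_def mset_mean_diff)
      with G_mean[OF scale_mem[OF f_mem], of c M] show ?thesis
        using LIMSEQ_unique by blast
    qed
    \<comment> \<open>The mean of \<open>f M\<close> over \<open>P\<close> tends to \<open>E\<close>
      and its norm to \<open>sqrt E\<close>; as its integral is 0, the quotient is the error of the
      normalised function.\<close>
    have "(\<lambda>M. \<bar>mset_mean P (\<lambda>x. mset_mean P (K x)) - mset_mean P (\<lambda>x. mset_mean (G M) (K x))\<bar>
          / sqrt (D M)) \<longlonglongrightarrow>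
        \<bar>mset_mean P (\<lambda>x. mset_mean P (K x)) - 1\<bar> / sqrt E"
      using E by (intro tendsto_intros PG D) auto
    also have "\<bar>mset_mean P (\<lambda>x. mset_mean P (K x)) - 1\<bar> / sqrt E = sqrt E"
      using E by (simp add: E_def [symmetric] real_div_sqrt)
    finally have "(\<lambda>M. ereal (\<bar>mset_mean P (\<lambda>x. mset_mean P (K x)) - mset_mean P (\<lambda>x. mset_mean (G M) (K x))\<bar>
          / sqrt (D M))) \<longlonglongrightarrow> ereal (sqrt E)" by simp
    then show ?thesis
    proof (rule tendsto_upperbound)
      show "\<forall>\<^sub>F M in sequentially. ereal (\<bar>mset_mean P (\<lambda>x. mset_mean P (K x)) -
          mset_mean P (\<lambda>x. mset_mean (G M) (K x))\<bar> / sqrt (D M)) \<le> wor_error P H (fun_norm ip)"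
        using eventually_gt_at_top[of 0] order_tendstoD(1)[OF D E]
      proof eventually_elim
        case (elim M)
        define c where "c = 1 / sqrt (D M)"
        have "fun_norm ip (\<lambda>x. c * f M x) = \<bar>c\<bar> * fun_norm ip (f M)"
          unfolding fun_norm_def using f_mem[of M] scale_mem[OF f_mem, of c M]
          by (simp add: ip_scale ip_scale_right real_sqrt_mult)
        also have "\<dots> = 1" using elim by (simp add: c_def norm_f)
        finally have "fun_norm ip (\<lambda>x. c * f M x) \<le> 1" by simp
        moreover have "mset_mean P (\<lambda>x. c * f M x) = c * (mset_mean P (\<lambda>x. mset_mean P (K x)) -
            mset_mean P (\<lambda>x. mset_mean (G M) (K x)))"
          using P by (simp add: f_def mset_mean_cmult mset_mean_diff mset_mean_mean_section)
        then have "1 / real (size P) * (\<Sum>x\<in>#P. c * f M x) - (LINT x:cbox 0 1|lborel. c * f M x) =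
            c * (mset_mean P (\<lambda>x. mset_mean P (K x)) - mset_mean P (\<lambda>x. mset_mean (G M) (K x)))"
          using int_f[of M c] elim by (simp add: mset_mean_def)
        then have "\<bar>mset_mean P (\<lambda>x. mset_mean P (K x)) - mset_mean P (\<lambda>x. mset_mean (G M) (K x))\<bar>
            / sqrt (D M) = \<bar>1 / real (size P) * (\<Sum>x\<in>#P. c * f M x) - (LINT x:cbox 0 1|lborel. c * f M x)\<bar>"
          using elim by (simp only: abs_mult) (simp add: c_def)
        ultimately show ?case
          unfolding wor_error_def
          by (intro SUP_upper2[of "\<lambda>x. c * f M x"]) (simp_all add: scale_mem f_mem)
      qed
    qed simp
  qed
  ultimately have "wor_error P H (fun_norm ip) = ereal (sqrt E)" by (rule antisym)
  then show ?thesis using E by (simp add: E_def)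
qed

section \<open>Bernoulli polynomials\<close>

lemma bernoulli_sum_eq_0:
  assumes "n \<ge> 2"
  shows "(\<Sum>k<n. real (n choose k) * bernoulli k) = 0"
proof -
  obtain m where n: "n = Suc (Suc m)" using assms by (metis add_2_eq_Suc le_Suc_ex)
  have "real (n choose Suc m) = real (m + 2)"
    using binomial_symmetric[of "Suc m" n] by (simp add: n)
  then have "(\<Sum>k<n. real (n choose k) * bernoulli k) =
      (\<Sum>k\<le>m. real (n choose k) * bernoulli k) + real (m + 2) * bernoulli (Suc m)"
    by (simp add: n lessThan_Suc_atMost del: bernoulli.simps binomial_Suc_Suc)
  also have "real (m + 2) * bernoulli (Suc m) = - (\<Sum>k\<le>m. real (n choose k) * bernoulli k)"
    by (simp add: n del: binomial_Suc_Suc)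
  finally show ?thesis by simp
qed

lemma bernpoly_0: "bernpoly n 0 = bernoulli n"
  unfolding bernpoly_def by (subst sum.remove[of _ n]) (auto intro!: sum.neutral)

lemma bernpoly_1: "n \<ge> 2 \<Longrightarrow> bernpoly n 1 = bernoulli n"
  using bernoulli_sum_eq_0[of n]
  by (simp add: bernpoly_def lessThan_Suc_atMost[symmetric])

lemma bernpoly_degree_0: "bernpoly 0 x = 1"
  by (simp add: bernpoly_def)

lemma bernpoly_degree_1: "bernpoly (Suc 0) x = x - 1 / 2"
  by (simp add: bernpoly_def)

lemma has_field_derivative_bernpoly:
  "(bernpoly (Suc n) has_field_derivative real (Suc n) * bernpoly n x) (at x within A)"
proof -
  have "((\<lambda>x. \<Sum>k\<le>n. real (Suc n choose k) * bernoulli k * x ^ (Suc n - k)) has_field_derivative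
     (\<Sum>k\<le>n. real (Suc n choose k) * bernoulli k * (real (Suc n - k) * x ^ (n - k)))) (at x within A)"
    by (auto intro!: derivative_eq_intros sum.cong simp del: binomial_Suc_Suc)
  moreover have "(\<Sum>k\<le>n. real (Suc n choose k) * bernoulli k * (real (Suc n - k) * x ^ (n - k)))
     = real (Suc n) * bernpoly n x"
    unfolding bernpoly_def sum_distrib_left
  proof (rule sum.cong)
    fix k assume "k \<in> {..n}"
    then have *: "real (Suc n choose k) * real (Suc n - k) = real (Suc n) * real (n choose k)"
      using binomial_absorb_comp[of "Suc n" k] by (metis of_nat_mult mult.commute diff_Suc_1)
    have "real (Suc n choose k) * bernoulli k * (real (Suc n - k) * x ^ (n - k)) =
        (real (Suc n choose k) * real (Suc n - k)) * (bernoulli k * x ^ (n - k))"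
      by (simp only: mult_ac)
    then show "real (Suc n choose k) * bernoulli k * (real (Suc n - k) * x ^ (n - k)) =
        real (Suc n) * (real (n choose k) * bernoulli k * x ^ (n - k))"
      unfolding * by (simp only: mult_ac)
  qed simp
  ultimately have "((\<lambda>x. \<Sum>k\<le>n. real (Suc n choose k) * bernoulli k * x ^ (Suc n - k))
      has_field_derivative real (Suc n) * bernpoly n x) (at x within A)"
    by (simp only:)
  from DERIV_add[OF this DERIV_const[of "bernoulli (Suc n)"]]
  have "((\<lambda>x. (\<Sum>k\<le>n. real (Suc n choose k) * bernoulli k * x ^ (Suc n - k)) + bernoulli (Suc n))
      has_field_derivative real (Suc n) * bernpoly n x) (at x within A)"
    by (simp only: add_0_right)
  moreover have "bernpoly (Suc n) =
      (\<lambda>x. (\<Sum>k\<le>n. real (Suc n choose k) * bernoulli k * x ^ (Suc n - k)) + bernoulli (Suc n))"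
    by (rule ext) (simp only: bernpoly_def sum.atMost_Suc binomial_n_n diff_self_eq_0 power_0
        of_nat_1 mult_1 mult_1_right)
  ultimately show ?thesis by (simp only:)
qed

lemma continuous_on_bernpoly [continuous_intros]:
  "continuous_on A f \<Longrightarrow> continuous_on A (\<lambda>x. bernpoly n (f x))"
  unfolding bernpoly_def by (intro continuous_intros)

text \<open>The difference \<open>d\<close> of the two sides satisfies, up to sign, the derivative
  rule of the Bernoulli polynomials, so by induction \<open>d (Suc n)\<close> is constant.\<close>

lemma bernpoly_reflect: "bernpoly n (1 - x) = (-1) ^ n * bernpoly n x"
proof (induction n arbitrary: x)
  case 0
  then show ?case by (simp add: bernpoly_degree_0)
next
  case (Suc n)
  define d where "d m x = bernpoly m (1 - x) - (-1) ^ m * bernpoly m x" for m and x :: real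
  have der: "(d (Suc m) has_field_derivative - real (Suc m) * d m x) (at x)" for m x
  proof -
    have "((\<lambda>x. 1 - x) has_field_derivative (-1 :: real)) (at x)"
      by (auto intro!: derivative_eq_intros)
    from DERIV_diff[OF DERIV_chain2[OF has_field_derivative_bernpoly this]
        DERIV_cmult[OF has_field_derivative_bernpoly]]
    have "(d (Suc m) has_field_derivative real (Suc m) * bernpoly m (1 - x) * -1
        - (-1) ^ Suc m * (real (Suc m) * bernpoly m x)) (at x)"
      unfolding d_def .
    then show ?thesis by (rule DERIV_cong) (simp add: d_def algebra_simps del: of_nat_Suc)
  qed
  have "(d (Suc n) has_field_derivative 0) (at x)" for x
    using der[of n x] Suc by (simp add: d_def)
  then have const: "d (Suc n) x = d (Suc n) 0" for x
    using DERIV_isconst_all by blast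
  \<comment> \<open>The constant is found one degree higher: \<open>d (Suc (Suc n))\<close> is
    affine with slope \<open>- c\<close> and takes equal values at 0 and 1, so
    \<open>c = 0\<close>.\<close>
  define c where "c = real (Suc (Suc n)) * d (Suc n) 0"
  have "((\<lambda>x. d (Suc (Suc n)) x + c * x) has_field_derivative 0) (at x)" for x
    using DERIV_add[OF der[of "Suc n" x] DERIV_cmult[OF DERIV_ident, of c x UNIV]] const[of x]
    by (simp add: c_def del: of_nat_Suc)
  then have "d (Suc (Suc n)) 1 + c * 1 = d (Suc (Suc n)) 0 + c * 0"
    using DERIV_isconst_all[of "\<lambda>x. d (Suc (Suc n)) x + c * x" 1 0] by blast
  moreover have "d (Suc (Suc n)) 1 = d (Suc (Suc n)) 0"
    by (simp add: d_def bernpoly_0 bernpoly_1 del: bernoulli.simps)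
  ultimately have "d (Suc n) 0 = 0" by (simp add: c_def)
  then show ?case using const[of x] by (simp add: d_def)
qed

text \<open>Two integrations by parts, with \<open>G\<close> collecting both boundary terms. The
  sine vanishes at both ends because \<open>w\<close> is a multiple of
  \<open>2 * pi\<close>.\<close>

lemma has_integral_bernpoly_cos_rec:
  assumes h: "h > 0" and I: "(( \<lambda>x. bernpoly n x * cos (2 * pi * real h * x)) has_integral I) {0..1}"
  shows "((\<lambda>x. bernpoly (Suc (Suc n)) x * cos (2 * pi * real h * x)) has_integral
     (real (Suc (Suc n)) * (bernpoly (Suc n) 1 - bernpoly (Suc n) 0)
       - real (Suc (Suc n)) * real (Suc n) * I) / (2 * pi * real h)\<^sup>2) {0..1}"
proof -
  define w where "w = 2 * pi * real h"
  have w: "w > 0" using h by (simp add: w_def)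
  define G where "G x = bernpoly (Suc (Suc n)) x * sin (w * x) / w
      + real (Suc (Suc n)) * bernpoly (Suc n) x * cos (w * x) / w\<^sup>2" for x
  have "((\<lambda>x. bernpoly (Suc (Suc n)) x * cos (w * x) +
     real (Suc (Suc n)) * real (Suc n) / w\<^sup>2 * (bernpoly n x * cos (w * x))) has_integral (G 1 - G 0)) {0..1}"
  proof (rule fundamental_theorem_of_calculus)
    fix x :: real
    have "(G has_field_derivative bernpoly (Suc (Suc n)) x * cos (w * x) +
     real (Suc (Suc n)) * real (Suc n) / w\<^sup>2 * (bernpoly n x * cos (w * x))) (at x within {0..1})"
      unfolding G_def using w
      by (auto intro!: derivative_eq_intros has_field_derivative_bernpoly
        simp: field_simps power2_eq_square simp del: of_nat_Suc)
    then show "(G has_vector_derivative bernpoly (Suc (Suc n)) x * cos (w * x) +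
     real (Suc (Suc n)) * real (Suc n) / w\<^sup>2 * (bernpoly n x * cos (w * x))) (at x within {0..1})"
      by (simp add: has_real_derivative_iff_has_vector_derivative)
  qed simp
  from has_integral_diff[OF this, of "\<lambda>x. real (Suc (Suc n)) * real (Suc n) / w\<^sup>2 * (bernpoly n x * cos (w * x))"
      "real (Suc (Suc n)) * real (Suc n) / w\<^sup>2 * I"]
  have "((\<lambda>x. bernpoly (Suc (Suc n)) x * cos (w * x)) has_integral
      (G 1 - G 0 - real (Suc (Suc n)) * real (Suc n) / w\<^sup>2 * I)) {0..1}"
    if "((\<lambda>x. real (Suc (Suc n)) * real (Suc n) / w\<^sup>2 * (bernpoly n x * cos (w * x)))
      has_integral (real (Suc (Suc n)) * real (Suc n) / w\<^sup>2 * I)) {0..1}"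
    using that by (simp only: add_diff_cancel_right')
  moreover have "((\<lambda>x. real (Suc (Suc n)) * real (Suc n) / w\<^sup>2 * (bernpoly n x * cos (w * x)))
      has_integral (real (Suc (Suc n)) * real (Suc n) / w\<^sup>2 * I)) {0..1}"
    by (rule has_integral_mult_right) (use I in \<open>simp add: w_def\<close>)
  ultimately have "((\<lambda>x. bernpoly (Suc (Suc n)) x * cos (w * x)) has_integral
      (G 1 - G 0 - real (Suc (Suc n)) * real (Suc n) / w\<^sup>2 * I)) {0..1}"
    by blast
  moreover have "sin w = 0" "cos w = 1"
    using sin_integer_2pi[of "real h"] cos_integer_2pi[of "real h"] by (auto simp: w_def mult_ac)
  then have "G 1 - G 0 = real (Suc (Suc n)) * (bernpoly (Suc n) 1 - bernpoly (Suc n) 0) / w\<^sup>2"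
    by (simp add: G_def right_diff_distrib diff_divide_distrib del: of_nat_Suc)
  then have "G 1 - G 0 - real (Suc (Suc n)) * real (Suc n) / w\<^sup>2 * I =
      (real (Suc (Suc n)) * (bernpoly (Suc n) 1 - bernpoly (Suc n) 0)
       - real (Suc (Suc n)) * real (Suc n) * I) / w\<^sup>2"
    by (simp only: diff_divide_distrib times_divide_eq_left)
  ultimately show ?thesis by (simp only: w_def)
qed

lemma has_integral_cos_nat:
  "((\<lambda>x. cos (2 * pi * real h * x)) has_integral (if h = 0 then 1 else 0)) {0..1}"
proof (cases "h = 0")
  case True
  then show ?thesis using has_integral_const_real[of "1::real" 0 1] by simp
next
  case False
  define w where "w = 2 * pi * real h"
  have w: "w > 0" using False by (simp add: w_def)
  have "((\<lambda>x. cos (w * x)) has_integral sin (w * 1) / w - sin (w * 0) / w) {0..1}"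
    by (rule fundamental_theorem_of_calculus)
      (use w in \<open>auto intro!: derivative_eq_intros simp: has_real_derivative_iff_has_vector_derivative[symmetric]\<close>)
  moreover have "sin w = 0" using sin_integer_2pi[of "real h"] by (auto simp: w_def mult_ac)
  ultimately show ?thesis using False by (simp add: w_def)
qed

text \<open>Product-to-sum formula. Positivity of \<open>k\<close> excludes
  \<open>k = h = 0\<close>, where the integral is 1 instead of \<open>1 / 2\<close>.\<close>

lemma has_integral_cos_cos_nat:
  assumes "k > 0"
  shows "((\<lambda>x. cos (2 * pi * real k * x) * cos (2 * pi * real h * x)) has_integral
     (if k = h then 1 / 2 else 0)) {0..1}"
proof -
  have *: "cos (2 * pi * real k * x) * cos (2 * pi * real h * x) =
     1 / 2 * (cos (2 * pi * real (if h \<le> k then k - h else h - k) * x) + cos (2 * pi * real (k + h) * x))" for x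
  proof -
    have "cos (2 * pi * real (if h \<le> k then k - h else h - k) * x) = cos (2 * pi * real k * x - 2 * pi * real h * x)"
    proof (cases "h \<le> k")
      case True
      then show ?thesis by (simp add: of_nat_diff algebra_simps)
    next
      case False
      then have "2 * pi * real (if h \<le> k then k - h else h - k) * x = - (2 * pi * real k * x - 2 * pi * real h * x)"
        by (simp add: of_nat_diff algebra_simps)
      then show ?thesis by (metis cos_minus)
    qed
    moreover have "2 * pi * real (k + h) * x = 2 * pi * real k * x + 2 * pi * real h * x"
      by (simp add: algebra_simps)
    ultimately show ?thesis
      unfolding cos_times_cos by (simp del: of_nat_add)
  qed
  have "((\<lambda>x. 1 / 2 * (cos (2 * pi * real (if h \<le> k then k - h else h - k) * x) + cos (2 * pi * real (k + h) * x)))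
    has_integral 1 / 2 * ((if (if h \<le> k then k - h else h - k) = 0 then 1 else 0) + (if k + h = 0 then 1 else 0))) {0..1}"
    by (intro has_integral_mult_right has_integral_add has_integral_cos_nat)
  moreover have "1 / 2 * ((if (if h \<le> k then k - h else h - k) = 0 then 1 else 0) + (if k + h = 0 then 1 else 0)) =
      (if k = h then 1 / 2 else (0 :: real))"
    using assms by auto
  ultimately show ?thesis by (simp only: *)
qed

text \<open>The only boundary contribution is the jump
  \<open>bernpoly 1 1 - bernpoly 1 0 = 1\<close> in the base case; later odd degrees have equal end
  values, and each step merely multiplies by the factor from the recurrence.\<close>

lemma has_integral_bernpoly_cos:
  assumes "m > 0" "h > 0"
  shows "((\<lambda>x. bernpoly (2 * m) x * cos (2 * pi * real h * x)) has_integral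
     (- ((-1) ^ m) * fact (2 * m) / (2 * pi * real h) ^ (2 * m))) {0..1}"
  using \<open>m > 0\<close>
proof (induction m rule: nat_induct_non_zero)
  case 1
  have "((\<lambda>x. bernpoly 0 x * cos (2 * pi * real h * x)) has_integral 0) {0..1}"
    using has_integral_cos_nat[of h] assms by (simp add: bernpoly_degree_0)
  note rec = has_integral_bernpoly_cos_rec[OF \<open>h > 0\<close> this]
  have "2 * 1 = Suc (Suc 0)" by simp
  then show ?case
    by (simp only:) (rule has_integral_eq_rhs[OF rec], simp add: bernpoly_degree_1 power2_eq_square)
next
  case (Suc m)
  have eq: "bernpoly (Suc (2 * m)) 1 = bernpoly (Suc (2 * m)) 0"
    using Suc by (simp add: bernpoly_0 bernpoly_1 del: bernoulli.simps)
  have *: "(a * 0 - a * b * (- e * f / w ^ (2 * m))) / w\<^sup>2 = e * (a * (b * f)) / w ^ Suc (Suc (2 * m))"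
    for a b e f w :: real
    by (simp add: power2_eq_square mult_ac)
  note rec = has_integral_bernpoly_cos_rec[OF \<open>h > 0\<close> Suc.IH, unfolded eq diff_self *]
  have "2 * Suc m = Suc (Suc (2 * m))" by simp
  then show ?case
    by (simp only:) (rule has_integral_eq_rhs[OF rec], simp del: power_Suc of_nat_Suc add: power_Suc[of "-1 :: real"])
qed

lemma has_integral_bernpoly:
  assumes "n > 0" shows "(bernpoly n has_integral 0) {0..1}"
proof -
  have "(bernpoly n has_integral bernpoly (Suc n) 1 / real (Suc n) - bernpoly (Suc n) 0 / real (Suc n)) {0..1}"
  proof (rule fundamental_theorem_of_calculus)
    fix x :: real
    have "((\<lambda>x. bernpoly (Suc n) x / real (Suc n)) has_field_derivative bernpoly n x) (at x within {0..1})"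
      using DERIV_cdivide[OF has_field_derivative_bernpoly[of n x "{0..1}"], of "real (Suc n)"] by simp
    then show "((\<lambda>x. bernpoly (Suc n) x / real (Suc n)) has_vector_derivative bernpoly n x) (at x within {0..1})"
      by (simp add: has_real_derivative_iff_has_vector_derivative)
  qed simp
  then show ?thesis using assms by (simp add: bernpoly_0 bernpoly_1 del: bernoulli.simps)
qed

section \<open>Cosine series\<close>

text \<open>For even \<open>n\<close> this is the sum of
  \<open>exp (2 * pi * i * h * x) / h ^ n\<close> over the nonzero integers, with \<open>h\<close>
  and \<open>-h\<close> paired, hence the factor 2. The index \<open>h\<close> stands for the
  frequency \<open>Suc h\<close>.\<close>

definition cos_series :: "nat \<Rightarrow> real \<Rightarrow> real" where
  "cos_series n x = (\<Sum>h. 2 * cos (2 * pi * real (Suc h) * x) / real (Suc h) ^ n)"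

lemma summable_cos_series_bound: "n \<ge> 2 \<Longrightarrow> summable (\<lambda>h. 2 / real (Suc h) ^ n)"
  using summable_mult[OF inverse_power_summable[of n, where 'a = real], of 2]
  by (subst summable_Suc_iff) (simp add: divide_inverse)

lemma abs_cos_series_term_le: "\<bar>2 * cos t / real (Suc h) ^ n\<bar> \<le> 2 / real (Suc h) ^ n"
  by (simp add: abs_mult divide_right_mono)

lemma summable_cos_series:
  "n \<ge> 2 \<Longrightarrow> summable (\<lambda>h. 2 * cos (2 * pi * real (Suc h) * x) / real (Suc h) ^ n)"
  by (rule summable_comparison_test'[OF summable_cos_series_bound[of n], of 0])
    (assumption, metis abs_cos_series_term_le real_norm_def)

lemma cos_series_sums:
  "n \<ge> 2 \<Longrightarrow> (\<lambda>h. 2 * cos (2 * pi * real (Suc h) * x) / real (Suc h) ^ n) sums cos_series n x"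
  unfolding cos_series_def by (intro summable_sums summable_cos_series)

lemma uniform_limit_cos_series:
  assumes "n \<ge> 2"
  shows "uniform_limit A (\<lambda>m x. \<Sum>h<m. 2 * cos (2 * pi * real (Suc h) * x) / real (Suc h) ^ n)
    (cos_series n) sequentially"
  unfolding cos_series_def[abs_def]
  by (rule Weierstrass_m_test[OF _ summable_cos_series_bound[OF assms]])
    (metis abs_cos_series_term_le real_norm_def)

lemma continuous_on_cos_series:
  "n \<ge> 2 \<Longrightarrow> continuous_on A (cos_series n)"
  by (rule uniform_limit_theorem[OF _ uniform_limit_cos_series])
    (auto intro!: always_eventually continuous_intros simp del: of_nat_Suc)

lemma cos_series_minus: "cos_series n (- x) = cos_series n x"
  by (simp add: cos_series_def)

lemma cos_series_add_int: "cos_series n (x + of_int k) = cos_series n x"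
proof -
  have "cos (2 * pi * real (Suc h) * (x + of_int k)) = cos (2 * pi * real (Suc h) * x)" for h
  proof -
    have *: "2 * pi * real (Suc h) * (x + of_int k) =
      2 * pi * real (Suc h) * x + 2 * pi * of_int (int (Suc h) * k)"
      by (simp add: algebra_simps)
    show ?thesis
      unfolding * cos_add cos_int_2pin sin_int_2pin by simp
  qed
  then show ?thesis by (simp only: cos_series_def)
qed

lemma cos_series_one_minus: "cos_series n (1 - x) = cos_series n x"
  using cos_series_add_int[of n "- x" 1] by (simp add: cos_series_minus)

lemma cos_series_frac: "cos_series n (frac x) = cos_series n x"
  using cos_series_add_int[of n "frac x" "\<lfloor>x\<rfloor>"] by (simp add: frac_def)

lemma has_integral_cos_series_cos:
  assumes n: "n \<ge> 2"
  shows "((\<lambda>x. cos_series n x * cos (2 * pi * real k * x)) has_integral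
    (if k = 0 then 0 else 1 / real k ^ n)) {0..1}"
proof -
  let ?S = "\<lambda>m x. \<Sum>h<m. 2 * cos (2 * pi * real (Suc h) * x) / real (Suc h) ^ n"
  have "uniform_limit {0..1} (\<lambda>m x. ?S m x * cos (2 * pi * real k * x))
     (\<lambda>x. cos_series n x * cos (2 * pi * real k * x)) sequentially"
  proof (rule bounded_bilinear.bounded_uniform_limit[OF bounded_bilinear_mult])
    show "uniform_limit {0..1} ?S (cos_series n) sequentially"
      by (rule uniform_limit_cos_series[OF n])
    show "bounded (cos_series n ` {0..1})"
      by (intro compact_imp_bounded compact_continuous_image continuous_on_cos_series n) simp
    show "bounded ((\<lambda>x. cos (2 * pi * real k * x)) ` {0..1})"
      by (rule boundedI[of _ 1]) auto
  qed (rule uniform_limit_const)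
  then obtain I J where I: "\<And>m. ((\<lambda>x. ?S m x * cos (2 * pi * real k * x)) has_integral I m) {0..1}"
    and J: "((\<lambda>x. cos_series n x * cos (2 * pi * real k * x)) has_integral J) {0..1}"
    and IJ: "I \<longlonglongrightarrow> J"
    by (rule uniform_limit_integral) (auto intro!: continuous_intros simp del: of_nat_Suc)
  \<comment> \<open>The partial sum of length \<open>m\<close> holds the frequencies 1 to
    \<open>m\<close>, so from \<open>m = k\<close> on its coefficient at \<open>k\<close> no longer
    changes.\<close>
  have "I m = (if k = 0 then 0 else 1 / real k ^ n)" if "m \<ge> k" for m
  proof -
    have "((\<lambda>x. \<Sum>h<m. 2 / real (Suc h) ^ n * (cos (2 * pi * real (Suc h) * x) * cos (2 * pi * real k * x)))
      has_integral (\<Sum>h<m. 2 / real (Suc h) ^ n * (if Suc h = k then 1 / 2 else 0))) {0..1}"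
      by (intro has_integral_sum has_integral_mult_right has_integral_cos_cos_nat) auto
    also have "(\<lambda>x. \<Sum>h<m. 2 / real (Suc h) ^ n * (cos (2 * pi * real (Suc h) * x) * cos (2 * pi * real k * x)))
        = (\<lambda>x. ?S m x * cos (2 * pi * real k * x))"
      by (simp add: sum_distrib_right mult.assoc del: of_nat_Suc)
    finally have "I m = (\<Sum>h<m. 2 / real (Suc h) ^ n * (if Suc h = k then 1 / 2 else 0))"
      using I has_integral_unique by blast
    also have "\<dots> = (\<Sum>h<m. if h = k - 1 \<and> k \<noteq> 0 then 1 / real k ^ n else 0)"
      by (intro sum.cong) auto
    also have "\<dots> = (if k = 0 then 0 else 1 / real k ^ n)"
      using that by (cases "k = 0") (auto simp: sum.delta)
    finally show ?thesis .
  qed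
  then have "I \<longlonglongrightarrow> (if k = 0 then 0 else 1 / real k ^ n)"
    by (intro tendsto_eventually eventually_sequentiallyI) auto
  with IJ J show ?thesis using LIMSEQ_unique by blast
qed

text \<open>A function symmetric about \<open>1/2\<close> is a continuous function of \<open>cos (2 * pi * x)\<close>, so it is a
  uniform limit of polynomials in \<open>cos (2 * pi * x)\<close>.\<close>

lemma symmetric_eq_0_if_cos_coeffs_eq_0:
  assumes cont: "continuous_on {0..1} f"
    and sym: "\<And>x. x \<in> {0..1} \<Longrightarrow> f (1 - x) = f x"
    and coeff: "\<And>k. ((\<lambda>x. f x * cos (2 * pi * real k * x)) has_integral 0) {0..1}"
    and x: "x \<in> {0..1}"
  shows "f x = 0"
proof -
  \<comment> \<open>Multiplying by \<open>cos (2 * pi * x)\<close> shifts the frequency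
    \<open>k\<close> to \<open>k - 1\<close> and \<open>k + 1\<close>, so the vanishing for all
    frequencies survives every power. Frequency 0 has no lower neighbour and is reduced to frequency
    1.\<close>
  have cos_pow: "((\<lambda>x. f x * cos (2 * pi * x) ^ i * cos (2 * pi * real k * x)) has_integral 0) {0..1}" for i k
  proof (induction i arbitrary: k)
    case 0
    then show ?case using coeff by simp
  next
    case (Suc i)
    show ?case
    proof (cases k)
      case 0
      then show ?thesis using Suc[of 1] by (simp add: power_Suc2 mult.assoc del: power_Suc)
    next
      case (Suc l)
      have eq: "cos (2 * pi * x) * cos (2 * pi * real k * x) =
        1 / 2 * (cos (2 * pi * real l * x) + cos (2 * pi * real (Suc k) * x))" for x
      proof -
        have *: "2 * pi * real l * x = 2 * pi * real k * x - 2 * pi * x"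
          "2 * pi * real (Suc k) * x = 2 * pi * real k * x + 2 * pi * x"
          by (auto simp: Suc algebra_simps)
        have c: "cos (2 * pi * x) * cos (2 * pi * real k * x) =
            (cos (2 * pi * real k * x - 2 * pi * x) + cos (2 * pi * real k * x + 2 * pi * x)) / 2"
          by (subst mult.commute) (rule cos_times_cos)
        show ?thesis unfolding c * by simp
      qed
      have "((\<lambda>x. 1 / 2 * (f x * cos (2 * pi * x) ^ i * cos (2 * pi * real l * x)
          + f x * cos (2 * pi * x) ^ i * cos (2 * pi * real (Suc k) * x))) has_integral 1 / 2 * (0 + 0)) {0..1}"
        by (intro has_integral_mult_right has_integral_add Suc.IH)
      also have "(\<lambda>x. 1 / 2 * (f x * cos (2 * pi * x) ^ i * cos (2 * pi * real l * x)
          + f x * cos (2 * pi * x) ^ i * cos (2 * pi * real (Suc k) * x))) =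
          (\<lambda>x. f x * cos (2 * pi * x) ^ i * (cos (2 * pi * x) * cos (2 * pi * real k * x)))"
        unfolding eq by (simp add: fun_eq_iff distrib_left del: of_nat_Suc)
      finally show ?thesis
        by (simp only: power_Suc2 mult.assoc add_0_right mult_zero_right)
    qed
  qed
  \<comment> \<open>\<open>arccos\<close> inverts the cosine on the half period, that is for
    \<open>x\<close> up to \<open>1 / 2\<close>; the symmetry of \<open>f\<close> covers the other
    half.\<close>
  define g where "g y = f (arccos y / (2 * pi))" for y
  have cont_g: "continuous_on {-1..1} g"
    unfolding g_def
  proof (rule continuous_on_compose2[OF cont])
    show "continuous_on {-1..1} (\<lambda>y. arccos y / (2 * pi))"
      by (intro continuous_intros continuous_on_arccos') auto
    show "(\<lambda>y. arccos y / (2 * pi)) ` {-1..1} \<subseteq> {0..1}"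
    proof safe
      fix y :: real assume "y \<in> {-1..1}"
      then have "0 \<le> arccos y" "arccos y \<le> pi" by (auto intro: arccos_lbound arccos_ubound)
      then show "arccos y / (2 * pi) \<in> {0..1}" by (simp add: divide_le_eq)
    qed
  qed
  have fg: "f x = g (cos (2 * pi * x))" if "x \<in> {0..1}" for x
  proof -
    have half: "f x = g (cos (2 * pi * x))" if "x \<in> {0..1/2}" for x
      using that by (simp add: g_def arccos_cos mult_le_cancel_left_pos)
    show ?thesis
    proof (cases "x \<le> 1 / 2")
      case True
      then show ?thesis using half that by simp
    next
      case False
      have "cos (2 * pi * (1 - x)) = cos (2 * pi * x)"
        by (simp add: right_diff_distrib cos_diff)
      then show ?thesis using half[of "1 - x"] sym[OF that] that False by simp
    qed
  qed
  have sq_int: "(\<lambda>x. f x * f x) integrable_on {0..1}"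
    by (intro integrable_continuous_real continuous_intros cont)
  have int_f: "(\<lambda>x. \<bar>f x\<bar>) integrable_on {0..1}"
    by (intro integrable_continuous_real continuous_intros cont)
  define B where "B = integral {0..1} (\<lambda>x. \<bar>f x\<bar>)"
  have B: "B \<ge> 0" unfolding B_def by (intro integral_nonneg int_f) auto
  \<comment> \<open>\<open>f\<close> is orthogonal to every polynomial in
    \<open>cos (2 * pi * x)\<close>, so the integral of its square equals that of \<open>f\<close>
    times its approximation error.\<close>
  have le: "integral {0..1} (\<lambda>x. f x * f x) \<le> e * B" if "e > 0" for e
  proof -
    obtain p where p: "real_polynomial_function p" "\<And>y. y \<in> {-1..1} \<Longrightarrow> \<bar>g y - p y\<bar> < e"
      using Stone_Weierstrass_real_polynomial_function[OF _ cont_g \<open>e > 0\<close>] by auto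
    then obtain a m where a: "p = (\<lambda>y. \<Sum>i\<le>m. a i * y ^ i)"
      unfolding real_polynomial_function_iff_sum by blast
    have "((\<lambda>x. \<Sum>i\<le>m. a i * (f x * cos (2 * pi * x) ^ i * cos (2 * pi * real 0 * x)))
      has_integral (\<Sum>i\<le>m. a i * 0)) {0..1}"
      by (intro has_integral_sum has_integral_mult_right cos_pow) auto
    also have "(\<lambda>x. \<Sum>i\<le>m. a i * (f x * cos (2 * pi * x) ^ i * cos (2 * pi * real 0 * x))) =
      (\<lambda>x. f x * p (cos (2 * pi * x)))"
      by (simp add: a sum_distrib_left mult.left_commute)
    finally have fp: "((\<lambda>x. f x * p (cos (2 * pi * x))) has_integral 0) {0..1}" by simp
    have "((\<lambda>x. f x * f x - f x * p (cos (2 * pi * x))) has_integral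
        integral {0..1} (\<lambda>x. f x * f x) - 0) {0..1}"
      by (intro has_integral_diff fp integrable_integral sq_int)
    moreover have "((\<lambda>x. e * \<bar>f x\<bar>) has_integral e * B) {0..1}"
      unfolding B_def by (intro has_integral_mult_right integrable_integral int_f)
    ultimately have "integral {0..1} (\<lambda>x. f x * f x) - 0 \<le> e * B"
    proof (rule has_integral_le)
      fix x :: real assume x: "x \<in> {0..1}"
      have "f x * (f x - p (cos (2 * pi * x))) \<le> \<bar>f x\<bar> * \<bar>f x - p (cos (2 * pi * x))\<bar>"
        by (metis abs_ge_self abs_mult)
      also have "\<dots> \<le> \<bar>f x\<bar> * e"
        using p(2)[of "cos (2 * pi * x)"] fg[OF x] by (intro mult_left_mono) (auto simp: less_imp_le)
      finally show "f x * f x - f x * p (cos (2 * pi * x)) \<le> e * \<bar>f x\<bar>"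
        by (simp add: right_diff_distrib mult.commute)
    qed
    then show ?thesis by simp
  qed
  \<comment> \<open>Dividing by \<open>B + 1\<close> avoids a case distinction on
    \<open>B = 0\<close>.\<close>
  have "integral {0..1} (\<lambda>x. f x * f x) \<le> 0 + d" if "d > 0" for d
  proof -
    have "integral {0..1} (\<lambda>x. f x * f x) \<le> d / (B + 1) * B"
      using that B by (intro le) auto
    also have "\<dots> \<le> d" using that B by (simp add: divide_le_eq)
    finally show ?thesis by simp
  qed
  then have "integral {0..1} (\<lambda>x. f x * f x) \<le> 0" using field_le_epsilon by blast
  moreover have "integral {0..1} (\<lambda>x. f x * f x) \<ge> 0"
    by (intro integral_nonneg sq_int) auto
  ultimately have "integral {0..1} (\<lambda>x. f x * f x) = 0" by simp
  then have "\<forall>x\<in>{0..1}. f x * f x = 0"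
    using integral_eq_0_iff[OF continuous_on_mult[OF cont cont]] by simp
  then show ?thesis using x by simp
qed

text \<open>Even degree makes both sides symmetric about \<open>1 / 2\<close>. Both are continuous
  with equal cosine coefficients, so they agree on the closed interval without any theory of
  pointwise convergence of Fourier series.\<close>

theorem bernpoly_eq_cos_series:
  assumes m: "m > 0" and x: "x \<in> {0..1}"
  shows "bernpoly (2 * m) x = - ((-1) ^ m) * fact (2 * m) / (2 * pi) ^ (2 * m) * cos_series (2 * m) x"
proof -
  define c where "c = - ((-1) ^ m) * fact (2 * m) / (2 * pi) ^ (2 * m)"
  have n: "2 * m \<ge> 2" using m by simp
  have "bernpoly (2 * m) x - c * cos_series (2 * m) x = 0"
  proof (rule symmetric_eq_0_if_cos_coeffs_eq_0[OF _ _ _ x])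
    show "continuous_on {0..1} (\<lambda>x. bernpoly (2 * m) x - c * cos_series (2 * m) x)"
      by (intro continuous_intros continuous_on_cos_series n)
    show "bernpoly (2 * m) (1 - x) - c * cos_series (2 * m) (1 - x) = bernpoly (2 * m) x - c * cos_series (2 * m) x" for x
      by (simp add: bernpoly_reflect cos_series_one_minus)
    fix k
    have b: "((\<lambda>x. bernpoly (2 * m) x * cos (2 * pi * real k * x)) has_integral
        c * (if k = 0 then 0 else 1 / real k ^ (2 * m))) {0..1}"
    proof (cases "k = 0")
      case True
      then show ?thesis using has_integral_bernpoly[of "2 * m"] m by simp
    next
      case False
      then show ?thesis
        using has_integral_bernpoly_cos[OF m, of k] by (simp add: c_def power_mult_distrib)
    qed
    have "((\<lambda>x. c * (cos_series (2 * m) x * cos (2 * pi * real k * x))) has_integral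
        c * (if k = 0 then 0 else 1 / real k ^ (2 * m))) {0..1}"
      by (intro has_integral_mult_right has_integral_cos_series_cos n)
    from has_integral_diff[OF b this]
    show "((\<lambda>x. (bernpoly (2 * m) x - c * cos_series (2 * m) x) * cos (2 * pi * real k * x)) has_integral 0) {0..1}"
      by (simp add: left_diff_distrib mult.assoc)
  qed
  then show ?thesis by (simp add: c_def)
qed

section \<open>Quadrature of cosines\<close>

text \<open>Orthogonality of the characters of the integers modulo \<open>N\<close>, by a geometric
  sum.\<close>

lemma sum_cis_root_of_unity:
  assumes "N > 0"
  shows "(\<Sum>n<N. cis (2 * pi * of_int k * real n / real N)) = (if int N dvd k then of_nat N else 0)"
proof -
  let ?w = "cis (2 * pi * of_int k / real N)"
  have pow: "cis (2 * pi * of_int k * real n / real N) = ?w ^ n" for n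
    unfolding Complex.DeMoivre by (simp add: mult_ac)
  show ?thesis
  proof (cases "int N dvd k")
    case True
    then obtain l where "k = int N * l" by (rule dvdE)
    then have "2 * pi * of_int k / real N = 2 * pi * of_int l" using assms by simp
    then have "?w = 1" by (simp only: cis_multiple_2pi Ints_of_int)
    then show ?thesis using True by (simp add: pow)
  next
    case False
    have "?w \<noteq> 1"
    proof
      assume "?w = 1"
      then have "cos (2 * pi * of_int k / real N) = 1" by (simp add: complex_eq_iff)
      then obtain m :: int where "2 * pi * of_int k / real N = of_int m * 2 * pi"
        unfolding cos_one_2pi_int by blast
      then have "real_of_int k = real_of_int (m * int N)" using assms by (simp add: field_simps)
      then have "k = m * int N" by (simp only: of_int_eq_iff)
      with False show False by simp
    qed
    moreover have "?w ^ N = 1"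
    proof -
      have "?w ^ N = cis (2 * pi * of_int k)" using assms by (simp add: Complex.DeMoivre)
      then show ?thesis by (simp only: cis_multiple_2pi Ints_of_int)
    qed
    ultimately show ?thesis using False by (simp add: pow geometric_sum)
  qed
qed

lemma sum_cos_root_of_unity:
  assumes "N > 0"
  shows "(\<Sum>n<N. cos (t + 2 * pi * of_int k * real n / real N)) = (if int N dvd k then real N * cos t else 0)"
proof -
  have "(\<Sum>n<N. cos (t + 2 * pi * of_int k * real n / real N)) =
      Re (cis t * (\<Sum>n<N. cis (2 * pi * of_int k * real n / real N)))"
    by (simp add: sum_distrib_left cis_mult)
  then show ?thesis unfolding sum_cis_root_of_unity[OF assms] by simp
qed

section \<open>Midpoint means in one dimension\<close>

definition midpoint_mean :: "nat \<Rightarrow> (real \<Rightarrow> real) \<Rightarrow> real" where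
  "midpoint_mean M g = (\<Sum>i<M. g ((2 * real i + 1) / (2 * real M))) / real M"

lemma midpoint_mean_add: "midpoint_mean M (\<lambda>x. f x + g x) = midpoint_mean M f + midpoint_mean M g"
  by (simp add: midpoint_mean_def sum.distrib add_divide_distrib)

lemma midpoint_mean_cmult: "midpoint_mean M (\<lambda>x. c * f x) = c * midpoint_mean M f"
  by (simp add: midpoint_mean_def sum_distrib_left)

lemma midpoint_mean_sum: "midpoint_mean M (\<lambda>x. \<Sum>i\<in>A. f i x) = (\<Sum>i\<in>A. midpoint_mean M (f i))"
proof (induction A rule: infinite_finite_induct)
  case (insert i A)
  then show ?case by (simp add: midpoint_mean_add)
qed (simp_all add: midpoint_mean_def)

lemma midpoint_mean_cong:
  assumes "\<And>x. x \<in> {0..1} \<Longrightarrow> f x = g x"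
  shows "midpoint_mean M f = midpoint_mean M g"
proof -
  have "(2 * real i + 1) / (2 * real M) \<in> {0..1}" if "i < M" for i
  proof -
    have "2 * real i + 1 \<le> 2 * real M" "real M > 0" using that by linarith+
    then show ?thesis by simp
  qed
  then show ?thesis unfolding midpoint_mean_def by (simp add: assms)
qed

text \<open>Reversing the order of the nodes is the reflection \<open>x\<close> to
  \<open>1 - x\<close>, because midpoints avoid an unpaired end point. This removes the Bernoulli
  polynomials of odd degree.\<close>

lemma midpoint_mean_antisymmetric:
  assumes "\<And>x. g (1 - x) = - g x"
  shows "midpoint_mean M g = 0"
proof -
  have "(\<Sum>i<M. g ((2 * real i + 1) / (2 * real M))) = (\<Sum>i<M. g ((2 * real (M - Suc i) + 1) / (2 * real M)))"
    by (rule sum.nat_diff_reindex[symmetric])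
  also have "\<dots> = (\<Sum>i<M. - g ((2 * real i + 1) / (2 * real M)))"
  proof (rule sum.cong)
    fix i assume "i \<in> {..<M}"
    then have "(2 * real (M - Suc i) + 1) / (2 * real M) = 1 - (2 * real i + 1) / (2 * real M)"
      by (simp add: of_nat_diff field_simps)
    then show "g ((2 * real (M - Suc i) + 1) / (2 * real M)) = - g ((2 * real i + 1) / (2 * real M))"
      by (simp only: assms)
  qed simp
  finally show ?thesis by (simp add: midpoint_mean_def sum_negf)
qed

text \<open>The total weight of the frequencies from \<open>M\<close> on: the index is one less than
  the frequency, so the frequencies below \<open>M\<close> are the first \<open>M - 1\<close> terms.
  At \<open>M = 0\<close> truncated subtraction leaves the whole sum, which bounds the series
  itself.\<close>

definition cos_tail :: "nat \<Rightarrow> nat \<Rightarrow> real" where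
  "cos_tail n M = (\<Sum>h. 2 / real (Suc h) ^ n) - (\<Sum>h<M - 1. 2 / real (Suc h) ^ n)"

lemma cos_tail_tendsto_0:
  assumes "n \<ge> 2" shows "cos_tail n \<longlonglongrightarrow> 0"
proof -
  let ?b = "\<lambda>h. 2 / real (Suc h) ^ n"
  have "(\<lambda>M. \<Sum>h<M. ?b h) \<longlonglongrightarrow> (\<Sum>h. ?b h)"
    by (rule summable_LIMSEQ[OF summable_cos_series_bound[OF assms]])
  then have "(\<lambda>M. (\<Sum>h. ?b h) - (\<Sum>h<M. ?b h)) \<longlonglongrightarrow> (\<Sum>h. ?b h) - (\<Sum>h. ?b h)"
    by (intro tendsto_intros)
  then have "(\<lambda>M. cos_tail n (Suc M)) \<longlonglongrightarrow> 0" by (simp add: cos_tail_def)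
  then show ?thesis by (rule LIMSEQ_imp_Suc)
qed

lemma abs_cos_series_le:
  assumes "n \<ge> 2" shows "\<bar>cos_series n x\<bar> \<le> cos_tail n 0"
  using norm_sums_le[OF cos_series_sums[OF assms] summable_sums[OF summable_cos_series_bound[OF assms]]]
  by (simp add: cos_tail_def abs_mult divide_right_mono del: of_nat_Suc)

text \<open>The midpoint rule with \<open>M\<close> nodes integrates the frequencies below \<open>M\<close> exactly.\<close>

lemma abs_midpoint_mean_cos_series_le:
  assumes n: "n \<ge> 2" and M: "M > 0"
  shows "\<bar>midpoint_mean M (\<lambda>y. cos_series n (x - y))\<bar> \<le> cos_tail n M"
proof -
  let ?b = "\<lambda>h. 2 / real (Suc h) ^ n"
  let ?a = "\<lambda>h. midpoint_mean M (\<lambda>y. 2 * cos (2 * pi * real (Suc h) * (x - y)) / real (Suc h) ^ n)"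
  have a_sums: "?a sums midpoint_mean M (\<lambda>y. cos_series n (x - y))"
    unfolding midpoint_mean_def by (intro sums_divide sums_sum cos_series_sums n)
  have "(\<lambda>h. ?b h - (if h \<in> {..<M - 1} then ?b h else 0)) sums cos_tail n M"
    unfolding cos_tail_def
    by (intro sums_diff sums_If_finite_set summable_sums summable_cos_series_bound n) simp
  from norm_sums_le[OF a_sums this]
  show ?thesis
  proof (simp only: real_norm_def, goal_cases)
    case 1
    show ?case
    proof (rule 1)
      fix h
      have cos_mid: "\<bar>midpoint_mean M (\<lambda>y. cos (2 * pi * real (Suc h) * (x - y)))\<bar> \<le> (if Suc h < M then 0 else 1)"
      proof -
        \<comment> \<open>\<open>t\<close> is the phase at the first node. The half-step offset of
          the midpoints enters only through this phase, so the sum over roots of unity applies;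
          multiples of \<open>M\<close> alias to a term of modulus at most 1.\<close>
        define t where "t = 2 * pi * real (Suc h) * x - pi * real (Suc h) / real M"
        have "2 * pi * real (Suc h) * (x - (2 * real i + 1) / (2 * real M)) =
            t + 2 * pi * of_int (- int (Suc h)) * real i / real M" for i
          using M by (simp add: t_def field_simps)
        then have eq: "midpoint_mean M (\<lambda>y. cos (2 * pi * real (Suc h) * (x - y))) =
            (if int M dvd - int (Suc h) then real M * cos t else 0) / real M"
          unfolding midpoint_mean_def sum_cos_root_of_unity[OF M, symmetric] by simp
        have "\<not> int M dvd - int (Suc h)" if "Suc h < M"
          unfolding dvd_minus_iff using that by (intro zdvd_not_zless) auto
        moreover have "\<bar>real M * cos t\<bar> \<le> real M"
          using mult_left_mono[OF abs_cos_le_one, of "real M" t] by (simp add: abs_mult)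
        ultimately show ?thesis unfolding eq using M by auto
      qed
      have "?a h = ?b h * midpoint_mean M (\<lambda>y. cos (2 * pi * real (Suc h) * (x - y)))"
        unfolding midpoint_mean_cmult[symmetric] by (simp add: mult.commute)
      then have "\<bar>?a h\<bar> \<le> ?b h * (if Suc h < M then 0 else 1)"
        using cos_mid by (simp only: abs_mult) (intro mult_mono, auto)
      then show "\<bar>?a h\<bar> \<le> ?b h - (if h \<in> {..<M - 1} then ?b h else 0)"
        by (auto split: if_splits)
    qed
  qed
qed

section \<open>Product kernels and lattice points\<close>

lemma mset_mean_swap:
  "mset_mean P (\<lambda>x. mset_mean Q (F x)) = mset_mean Q (\<lambda>y. mset_mean P (\<lambda>x. F x y))"
  unfolding mset_mean_def sum_mset_distrib_left
  by (subst sum_mset.swap) (simp only: mult.left_commute)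

text \<open>The common shape of both kernels; \<open>k\<close> is the one-dimensional kernel without
  its constant 1.\<close>

definition weighted_kernel ::
  "('s::finite set \<Rightarrow> real) \<Rightarrow> (real \<Rightarrow> real \<Rightarrow> real) \<Rightarrow> real ^ 's \<Rightarrow> real ^ 's \<Rightarrow> real" where
  "weighted_kernel w k x y = 1 + (\<Sum>u\<in>{u. u \<noteq> {}}. w u * (\<Prod>j\<in>u. k (x $ j) (y $ j)))"

lemma mset_mean_weighted_kernel:
  "P \<noteq> {#} \<Longrightarrow> mset_mean P (weighted_kernel w k x) =
    1 + (\<Sum>u\<in>{u. u \<noteq> {}}. w u * mset_mean P (\<lambda>y. \<Prod>j\<in>u. k (x $ j) (y $ j)))"
  unfolding weighted_kernel_def
  by (simp add: mset_mean_add mset_mean_const mset_mean_sum mset_mean_cmult)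

lemma mset_mean_mset_mean_weighted_kernel:
  "P \<noteq> {#} \<Longrightarrow> mset_mean P (\<lambda>x. mset_mean P (weighted_kernel w k x)) =
    1 + (\<Sum>u\<in>{u. u \<noteq> {}}. w u * mset_mean P (\<lambda>x. mset_mean P (\<lambda>y. \<Prod>j\<in>u. k (x $ j) (y $ j))))"
  by (simp add: mset_mean_weighted_kernel mset_mean_add mset_mean_const mset_mean_sum mset_mean_cmult)

lemma continuous_on_weighted_kernel:
  assumes "continuous_on ({0..1} \<times> {0..1}) (\<lambda>p. k (fst p) (snd p))"
  shows "continuous_on (cbox 0 1 \<times> cbox 0 1) (\<lambda>p. weighted_kernel w k (fst p) (snd p))"
proof -
  have "continuous_on (cbox 0 1 \<times> cbox 0 1) (\<lambda>p. k (fst p $ j) (snd p $ j))" for j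
    using continuous_on_compose2[OF assms, of "cbox 0 1 \<times> cbox 0 1" "\<lambda>p. (fst p $ j, snd p $ j)"]
    by (force intro!: continuous_intros simp: mem_box_cart)
  then show ?thesis
    unfolding weighted_kernel_def by (intro continuous_intros)
qed

lemma mset_mean_midpoint_grid_prod:
  fixes u :: "'s::finite set"
  assumes M: "M > 0"
  shows "mset_mean (midpoint_grid M) (\<lambda>y. \<Prod>j\<in>u. g j (y $ j)) = (\<Prod>j\<in>u. midpoint_mean M (g j))"
proof -
  \<comment> \<open>Coordinates outside \<open>u\<close> receive the constant 1, whose midpoint mean
    is 1, so that the product over all coordinates factors along the grid.\<close>
  define g' where "g' j = (if j \<in> u then g j else (\<lambda>_. 1))" for j
  have prod_u: "(\<Prod>j\<in>u. f (g j) j) = (\<Prod>j\<in>UNIV. f (g' j) j)" if "\<And>j. f (\<lambda>_. 1) j = 1"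
    for f :: "(real \<Rightarrow> real) \<Rightarrow> 's \<Rightarrow> real"
    by (rule prod.mono_neutral_cong_left) (auto simp: g'_def that)
  have "mset_mean (midpoint_grid M) (\<lambda>y. \<Prod>j\<in>u. g j (y $ j)) =
      (\<Sum>m\<in>PiE UNIV (\<lambda>_. {..<M}). \<Prod>j\<in>UNIV. g' j ((2 * real (m j) + 1) / (2 * real M))) / real M ^ CARD('s)"
    unfolding mset_mean_midpoint_grid by (subst prod_u[where f = "\<lambda>h j. h (_ $ j)"]) auto
  also have "\<dots> = (\<Prod>j\<in>UNIV. midpoint_mean M (g' j))"
    unfolding midpoint_mean_def by (simp add: prod_dividef prod_sum_PiE)
  also have "\<dots> = (\<Prod>j\<in>u. midpoint_mean M (g j))"
    by (rule prod_u[symmetric, where f = "\<lambda>h j. midpoint_mean M h"]) (use M in \<open>simp add: midpoint_mean_def\<close>)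
  finally show ?thesis .
qed

text \<open>On the product grid every summand factors into one-dimensional means, which gives a
  bound free of \<open>x\<close>. It tends to 0 because \<open>u\<close> is nonempty, whereas
  \<open>0 ^ 0\<close> would be 1.\<close>

lemma uniform_limit_weighted_kernel:
  fixes w :: "'s::finite set \<Rightarrow> real"
  assumes k: "\<And>M x. M > 0 \<Longrightarrow> x \<in> {0..1} \<Longrightarrow> \<bar>midpoint_mean M (k x)\<bar> \<le> t M"
    and t: "t \<longlonglongrightarrow> 0"
  shows "uniform_limit (cbox 0 1) (\<lambda>M x. mset_mean (midpoint_grid M) (weighted_kernel w k x)) (\<lambda>x. 1) sequentially"
proof (rule uniform_limitI)
  fix e :: real assume e: "e > 0"
  define b where "b M = (\<Sum>u\<in>{u. u \<noteq> {}}. \<bar>w u\<bar> * t M ^ card u)" for M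
  have "b \<longlonglongrightarrow> (\<Sum>u\<in>{u. u \<noteq> {}}. \<bar>w u\<bar> * 0 ^ card u)"
    unfolding b_def by (intro tendsto_intros t)
  also have "(\<Sum>u\<in>{u. u \<noteq> {}}. \<bar>w u\<bar> * 0 ^ card u) = 0"
    by (intro sum.neutral) (auto simp: card_gt_0_iff)
  finally have "\<forall>\<^sub>F M in sequentially. b M < e" using e by (rule order_tendstoD)
  then show "\<forall>\<^sub>F M in sequentially. \<forall>x\<in>cbox 0 1.
      dist (mset_mean (midpoint_grid M) (weighted_kernel w k x)) 1 < e"
    using eventually_gt_at_top[of 0]
  proof eventually_elim
    case (elim M)
    show ?case
    proof
      fix x :: "real ^ 's" assume x: "x \<in> cbox 0 1"
      have "\<bar>\<Sum>u\<in>{u. u \<noteq> {}}. w u * (\<Prod>j\<in>u. midpoint_mean M (k (x $ j)))\<bar> \<le> b M"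
        unfolding b_def
      proof (rule order.trans[OF sum_abs sum_mono])
        fix u :: "'s set"
        have "\<bar>\<Prod>j\<in>u. midpoint_mean M (k (x $ j))\<bar> \<le> (\<Prod>j\<in>u. t M)"
          unfolding abs_prod using x elim k by (intro prod_mono) (auto simp: mem_box_cart)
        then show "\<bar>w u * (\<Prod>j\<in>u. midpoint_mean M (k (x $ j)))\<bar> \<le> \<bar>w u\<bar> * t M ^ card u"
          by (simp add: abs_mult mult_left_mono)
      qed
      with elim show "dist (mset_mean (midpoint_grid M) (weighted_kernel w k x)) 1 < e"
        by (simp add: mset_mean_weighted_kernel midpoint_grid_nonempty dist_real_def
            mset_mean_midpoint_grid_prod[where g = "\<lambda>j. k (x $ j)"])
    qed
  qed
qed

section \<open>Lattice points and their symmetrisation\<close>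

definition lattice_point :: "nat \<Rightarrow> nat ^ 's \<Rightarrow> nat \<Rightarrow> real ^ 's" where
  "lattice_point N z n = (\<chi> j. frac (real n * real (z $ j) / real N))"

lemma lattice_points_eq: "lattice_points N z = image_mset (lattice_point N z) (mset_set {..<N})"
  unfolding lattice_points_def lattice_point_def[abs_def] lessThan_atLeast0 ..

lemma mset_mean_lattice_points:
  "mset_mean (lattice_points N z) f = (\<Sum>n<N. f (lattice_point N z n)) / real N"
  by (simp add: lattice_points_eq mset_mean_image_mset mset_mean_mset_set)

lemma lattice_points_nonempty: "N > 0 \<Longrightarrow> lattice_points N z \<noteq> {#}"
  by (auto simp: lattice_points_eq mset_set_empty_iff)

lemma set_lattice_points: "set_mset (lattice_points N z) \<subseteq> cbox 0 1"
  by (auto simp: lattice_points_eq lattice_point_def mem_box_cart frac_lt_1 less_imp_le)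

lemma mset_mean_sym_lattice_points:
  fixes z :: "nat ^ 's"
  shows "mset_mean (sym_lattice_points N z) f =
    mset_mean (lattice_points N z) (\<lambda>x. (\<Sum>u\<in>Pow UNIV. f (sym_at u x)) / 2 ^ CARD('s))"
proof -
  let ?P = "\<lambda>U. \<Sum>u\<in>U. image_mset (sym_at u) (lattice_points N z)"
  have sum: "(\<Sum>x\<in>#?P U. f x) = (\<Sum>x\<in>#lattice_points N z. \<Sum>u\<in>U. f (sym_at u x))"
    and size: "size (?P U) = card U * size (lattice_points N z)" if "finite U" for U
    using that by (induction U) (simp_all add: sum_mset.distrib multiset.map_comp comp_def)
  have "card (Pow (UNIV :: 's set)) = 2 ^ CARD('s)" by (simp add: card_Pow)
  then show ?thesis
    unfolding mset_mean_def sym_lattice_points_def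
    by (subst sum, simp, subst size, simp)
      (simp add: divide_inverse mult_ac flip: sum_mset_distrib_left)
qed

lemma sym_lattice_points_nonempty: "N > 0 \<Longrightarrow> sym_lattice_points N z \<noteq> {#}"
  using lattice_points_nonempty[of N z]
  by (auto simp: sym_lattice_points_def dest!: sum_eq_empty_iff[THEN iffD1, rotated])

lemma set_sym_lattice_points: "set_mset (sym_lattice_points N z) \<subseteq> cbox 0 1"
proof -
  have sym: "sym_at u x \<in> cbox 0 1" if "x \<in> cbox 0 1" for u and x :: "real ^ 'a"
    using that by (simp add: sym_at_def mem_box_cart)
  have "set_mset (\<Sum>u\<in>U. image_mset (sym_at u) (lattice_points N z)) \<subseteq> cbox 0 1" for U
  proof (induction U rule: infinite_finite_induct)
    case (insert u U)
    have "sym_at u ` set_mset (lattice_points N z) \<subseteq> cbox 0 1"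
      using set_lattice_points[of N z] sym by blast
    with insert show ?case by simp
  qed auto
  then show ?thesis unfolding sym_lattice_points_def by blast
qed

text \<open>Multiplying out the product, \<open>u\<close> records the coordinates in which the
  reflected term is chosen. A coordinate outside \<open>w\<close> contributes
  \<open>1 / 2 + 1 / 2 = 1\<close>, which accounts for the full power of 2.\<close>

lemma sum_sym_at_prod:
  fixes x :: "real ^ 's" and g :: "'s \<Rightarrow> real \<Rightarrow> real"
  shows "(\<Sum>u\<in>Pow UNIV. \<Prod>j\<in>w. g j (sym_at u x $ j)) / 2 ^ CARD('s) =
    (\<Prod>j\<in>w. (g j (x $ j) + g j (1 - x $ j)) / 2)"
proof -
  define a where "a j = (if j \<in> w then g j (1 - x $ j) else 1) / 2" for j
  define b where "b j = (if j \<in> w then g j (x $ j) else 1) / 2" for j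
  have "(\<Prod>j\<in>w. (g j (x $ j) + g j (1 - x $ j)) / 2) = (\<Prod>j\<in>UNIV. a j + b j)"
    by (rule prod.mono_neutral_cong_left) (auto simp: a_def b_def add_divide_distrib)
  also have "\<dots> = (\<Sum>u\<in>Pow UNIV. prod a u * prod b (UNIV - u))"
    by (rule prod_add) simp
  also have "\<dots> = (\<Sum>u\<in>Pow UNIV. (\<Prod>j\<in>w. g j (sym_at u x $ j)) / 2 ^ CARD('s))"
  proof (rule sum.cong)
    fix u :: "'s set"
    have "prod a u * prod b (UNIV - u) = (\<Prod>j\<in>UNIV. if j \<in> u then a j else b j)"
      by (subst prod.If_cases) (auto simp: Compl_eq_Diff_UNIV)
    also have "\<dots> = (\<Prod>j\<in>UNIV. (if j \<in> w then g j (sym_at u x $ j) else 1) / 2)"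
      by (intro prod.cong) (auto simp: a_def b_def sym_at_def)
    also have "\<dots> = (\<Prod>j\<in>w. g j (sym_at u x $ j)) / 2 ^ CARD('s)"
      unfolding prod_dividef by (simp add: prod.If_cases)
    finally show "prod a u * prod b (UNIV - u) = (\<Prod>j\<in>w. g j (sym_at u x $ j)) / 2 ^ CARD('s)" .
  qed simp
  finally show ?thesis by (simp add: sum_divide_distrib)
qed

lemma mset_mean_sym_lattice_points_prod:
  "mset_mean (sym_lattice_points N z) (\<lambda>x. \<Prod>j\<in>w. g j (x $ j)) =
    mset_mean (lattice_points N z) (\<lambda>x. \<Prod>j\<in>w. (g j (x $ j) + g j (1 - x $ j)) / 2)"
  unfolding mset_mean_sym_lattice_points sum_sym_at_prod ..

definition sym_kernel :: "(real \<Rightarrow> real \<Rightarrow> real) \<Rightarrow> real \<Rightarrow> real \<Rightarrow> real" where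
  "sym_kernel k x y = (k x y + k x (1 - y) + k (1 - x) y + k (1 - x) (1 - y)) / 4"

text \<open>Coordinates are reflected independently of each other, so the reflections can be moved
  from the points to the one-dimensional kernel, one argument at a time.\<close>

lemma mset_mean_sym_lattice_points_prod_kernel:
  "mset_mean (sym_lattice_points N z) (\<lambda>x. mset_mean (sym_lattice_points N z) (\<lambda>y. \<Prod>j\<in>w. k (x $ j) (y $ j))) =
    mset_mean (lattice_points N z) (\<lambda>x. mset_mean (lattice_points N z) (\<lambda>y. \<Prod>j\<in>w. sym_kernel k (x $ j) (y $ j)))"
proof -
  have "mset_mean (sym_lattice_points N z) (\<lambda>x. mset_mean (sym_lattice_points N z) (\<lambda>y. \<Prod>j\<in>w. k (x $ j) (y $ j))) =
    mset_mean (lattice_points N z) (\<lambda>y. mset_mean (sym_lattice_points N z)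
       (\<lambda>x. \<Prod>j\<in>w. (k (x $ j) (y $ j) + k (x $ j) (1 - y $ j)) / 2))"
    by (subst mset_mean_sym_lattice_points_prod[where g = "\<lambda>j. k (_ $ j)"]) (rule mset_mean_swap)
  also have "\<dots> = mset_mean (lattice_points N z) (\<lambda>y. mset_mean (lattice_points N z)
       (\<lambda>x. \<Prod>j\<in>w. sym_kernel k (x $ j) (y $ j)))"
    by (subst mset_mean_sym_lattice_points_prod[where
         g = "\<lambda>j x. (k x (_ $ j) + k x (1 - _ $ j)) / 2"])
      (simp add: sym_kernel_def add_divide_distrib add_ac)
  finally show ?thesis by (subst mset_mean_swap)
qed

section \<open>Dual lattice and positivity\<close>

lemma prod_cis: "finite A \<Longrightarrow> (\<Prod>x\<in>A. cis (f x)) = cis (\<Sum>x\<in>A. f x)"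
  by (induction A rule: finite_induct) (simp_all add: cis_mult)

lemma has_sum_finite_sum:
  fixes f :: "'a \<Rightarrow> 'b \<Rightarrow> 'c :: topological_comm_monoid_add"
  assumes "\<And>i. i \<in> I \<Longrightarrow> (f i has_sum S i) A"
  shows "((\<lambda>x. \<Sum>i\<in>I. f i x) has_sum (\<Sum>i\<in>I. S i)) A"
  using assms
proof (induction I rule: infinite_finite_induct)
  case (insert i I)
  then show ?case by (simp add: has_sum_add)
qed simp_all

lemma has_sum_nonzero_int:
  fixes f :: "int \<Rightarrow> 'a :: banach"
  assumes "summable (\<lambda>k. norm (f (int (Suc k))))" "summable (\<lambda>k. norm (f (- int (Suc k))))"
  shows "(f has_sum (\<Sum>k. f (int (Suc k)) + f (- int (Suc k)))) (UNIV - {0})"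
proof -
  have pos: "(f has_sum (\<Sum>k. f (int (Suc k)))) (range (\<lambda>k. int (Suc k)))"
    using assms(1) by (subst has_sum_reindex)
      (auto simp: inj_on_def comp_def intro!: norm_summable_imp_has_sum summable_sums
        intro: summable_norm_cancel)
  have neg: "(f has_sum (\<Sum>k. f (- int (Suc k)))) (range (\<lambda>k. - int (Suc k)))"
    using assms(2) by (subst has_sum_reindex)
      (auto simp: inj_on_def comp_def intro!: norm_summable_imp_has_sum summable_sums
        intro: summable_norm_cancel)
  have "x \<in> range (\<lambda>k. int (Suc k)) \<union> range (\<lambda>k. - int (Suc k))" if "x \<noteq> 0" for x :: int
  proof (cases "x > 0")
    case True
    then have "x = int (Suc (nat x - 1))" by simp
    then show ?thesis by blast
  next
    case False
    then have "x = - int (Suc (nat (- x) - 1))" using that by simp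
    then show ?thesis by blast
  qed
  then have "UNIV - {0} = range (\<lambda>k. int (Suc k)) \<union> range (\<lambda>k. - int (Suc k))" by auto
  moreover have "range (\<lambda>k. int (Suc k)) \<inter> range (\<lambda>k. - int (Suc k)) = {}" by auto
  ultimately show ?thesis
    using has_sum_Un_disjoint[OF pos neg]
      suminf_add[OF summable_norm_cancel[OF assms(1)] summable_norm_cancel[OF assms(2)]] by simp
qed

text \<open>For even \<open>n\<close> the terms at \<open>h\<close> and \<open>-h\<close> are
  conjugate and add up to twice the cosine. Absolute summability is recorded for multiplying such
  series.\<close>

lemma
  assumes n: "n \<ge> 2" "even n"
  shows summable_on_norm_cis_power:
      "(\<lambda>h. norm (cis (2 * pi * of_int h * x) / of_int h ^ n)) summable_on (UNIV - {0::int})"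
    and has_sum_cis_power:
      "((\<lambda>h. cis (2 * pi * of_int h * x) / of_int h ^ n) has_sum of_real (cos_series n x)) (UNIV - {0::int})"
proof -
  let ?f = "\<lambda>h::int. cis (2 * pi * of_int h * x) / of_int h ^ n"
  have norm_f: "norm (?f h) = 1 / \<bar>of_int h\<bar> ^ n" for h
    by (simp add: norm_divide norm_power)
  have s: "summable (\<lambda>k. 1 / real (Suc k) ^ n)"
    using summable_divide[OF summable_cos_series_bound[OF n(1)], of 2] by simp
  have pos: "summable (\<lambda>k. norm (?f (int (Suc k))))" and neg: "summable (\<lambda>k. norm (?f (- int (Suc k))))"
    unfolding norm_f using s by (simp_all del: of_nat_Suc)
  show "(\<lambda>h. norm (?f h)) summable_on (UNIV - {0})"
    using has_sum_nonzero_int[of "\<lambda>h. norm (?f h)", unfolded real_norm_def abs_norm_cancel, OF pos neg]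
    by (rule has_sum_imp_summable)
  have "?f (int (Suc k)) + ?f (- int (Suc k)) =
      of_real (2 * cos (2 * pi * real (Suc k) * x) / real (Suc k) ^ n)" for k
  proof -
    let ?t = "2 * pi * real (Suc k) * x"
    have "?f (int (Suc k)) = cis ?t / of_real (real (Suc k) ^ n)"
      by simp
    moreover have "?f (- int (Suc k)) = cis (- ?t) / of_real (real (Suc k) ^ n)"
      by (simp add: uminus_power_if n(2) del: of_nat_Suc)
    moreover have "cis ?t + cis (- ?t) = of_real (2 * cos ?t)"
      by (simp add: complex_eq_iff del: of_nat_Suc)
    ultimately show ?thesis
      by (simp only: add_divide_distrib[symmetric] of_real_divide)
  qed
  then have "(\<Sum>k. ?f (int (Suc k)) + ?f (- int (Suc k))) = of_real (cos_series n x)"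
    by (simp only: sums_unique[OF sums_of_real[OF cos_series_sums[OF n(1)]], symmetric])
  then show "(?f has_sum of_real (cos_series n x)) (UNIV - {0})"
    using has_sum_nonzero_int[OF pos neg] by (simp only:)
qed

text \<open>The fractional parts of the lattice points are left out because
  \<open>cos_series\<close> has period 1.\<close>

definition cos_product_mean :: "nat \<Rightarrow> nat \<Rightarrow> nat ^ 's \<Rightarrow> 's set \<Rightarrow> real" where
  "cos_product_mean n N z u =
     (\<Sum>m<N. \<Prod>j\<in>u. cos_series n (real m * real (z $ j) / real N)) / real N"

text \<open>Absolute convergence lets the product of the character series be multiplied out over
  \<open>PiE\<close>. Averaging over the \<open>N\<close> points then keeps exactly the characters
  that are trivial on the lattice.\<close>

lemma infsum_dual_lattice:
  fixes z :: "nat ^ 's"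
  assumes n: "n \<ge> 2" "even n" and N: "N > 0"
  shows "(\<Sum>\<^sub>\<infinity>k\<in>dual_lattice N z u. \<Prod>j\<in>u. 1 / real_of_int (k j) ^ n) = cos_product_mean n N z u"
proof -
  let ?Z = "PiE u (\<lambda>_. UNIV - {0 :: int})"
  define c :: "('s \<Rightarrow> int) \<Rightarrow> real" where "c k = (\<Prod>j\<in>u. 1 / real_of_int (k j) ^ n)" for k
  define f where "f m j h = cis (2 * pi * of_int h * (real m * real (z $ j) / real N)) / of_int h ^ n"
    for m :: nat and j and h :: int
  have prod_f: "(\<Prod>j\<in>u. f m j (k j)) =
      of_real (c k) * cis (2 * pi * of_int (\<Sum>j\<in>u. k j * int (z $ j)) * real m / real N)" for m k
  proof -
    have "(\<Prod>j\<in>u. cis (2 * pi * of_int (k j) * (real m * real (z $ j) / real N))) =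
        cis (\<Sum>j\<in>u. 2 * pi * of_int (k j) * (real m * real (z $ j) / real N))"
      by (rule prod_cis) simp
    also have "(\<Sum>j\<in>u. 2 * pi * of_int (k j) * (real m * real (z $ j) / real N)) =
        2 * pi * of_int (\<Sum>j\<in>u. k j * int (z $ j)) * real m / real N"
      by (simp add: sum_distrib_left sum_distrib_right sum_divide_distrib mult_ac)
    finally show ?thesis
      unfolding f_def prod_dividef by (simp add: c_def prod_dividef)
  qed
  have sumf: "((\<lambda>k. \<Prod>j\<in>u. f m j (k j)) has_sum
      of_real (\<Prod>j\<in>u. cos_series n (real m * real (z $ j) / real N))) ?Z" for m
  proof -
    have nf: "(\<lambda>h. norm (f m j h)) summable_on (UNIV - {0})" for j
      unfolding f_def by (rule summable_on_norm_cis_power[OF n])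
    have "(\<lambda>k. \<Prod>j\<in>u. f m j (k j)) summable_on ?Z"
      by (rule abs_summable_summable, subst abs_summable_equivalent,
          rule abs_summable_on_prod_PiE) (auto simp: nf simp flip: abs_summable_equivalent)
    moreover have "infsum (\<lambda>k. \<Prod>j\<in>u. f m j (k j)) ?Z =
        (\<Prod>j\<in>u. infsum (f m j) (UNIV - {0}))"
      by (rule infsum_prod_PiE_abs) (auto simp: nf)
    moreover have "infsum (f m j) (UNIV - {0}) = of_real (cos_series n (real m * real (z $ j) / real N))" for j
      unfolding f_def by (rule infsumI has_sum_cis_power[OF n])+
    ultimately show ?thesis by (simp add: has_sum_iff)
  qed
  have "((\<lambda>k. \<Sum>m<N. \<Prod>j\<in>u. f m j (k j)) has_sum
      (\<Sum>m<N. of_real (\<Prod>j\<in>u. cos_series n (real m * real (z $ j) / real N)))) ?Z"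
    by (rule has_sum_finite_sum[OF sumf])
  also have "(\<lambda>k. \<Sum>m<N. \<Prod>j\<in>u. f m j (k j)) =
      (\<lambda>k. of_real (c k * (if int N dvd (\<Sum>j\<in>u. k j * int (z $ j)) then real N else 0)))"
    unfolding prod_f sum_distrib_left[symmetric] sum_cis_root_of_unity[OF N] by (simp add: fun_eq_iff)
  finally have "((\<lambda>k. c k * (if int N dvd (\<Sum>j\<in>u. k j * int (z $ j)) then real N else 0)) has_sum
      (\<Sum>m<N. \<Prod>j\<in>u. cos_series n (real m * real (z $ j) / real N))) ?Z"
    unfolding of_real_sum[symmetric] has_sum_of_real_iff .
  also have "?this \<longleftrightarrow> ((\<lambda>k. c k * real N) has_sum
      (\<Sum>m<N. \<Prod>j\<in>u. cos_series n (real m * real (z $ j) / real N))) (dual_lattice N z u)"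
    by (rule has_sum_cong_neutral) (auto simp: dual_lattice_def dvd_eq_mod_eq_0)
  finally have "((\<lambda>k. c k * real N / real N) has_sum
      (\<Sum>m<N. \<Prod>j\<in>u. cos_series n (real m * real (z $ j) / real N)) / real N) (dual_lattice N z u)"
    by (rule has_sum_divide_const)
  moreover have "c k * real N / real N = c k" for k using N by simp
  ultimately have "(c has_sum cos_product_mean n N z u) (dual_lattice N z u)"
    by (simp only: cos_product_mean_def)
  then show ?thesis unfolding c_def by (rule infsumI)
qed

text \<open>Hidden in the defining mean, whose terms may be negative; in the dual form every term is
  nonnegative because \<open>n\<close> is even.\<close>

lemma cos_product_mean_nonneg:
  assumes n: "n \<ge> 2" "even n" and N: "N > 0"
  shows "cos_product_mean n N z u \<ge> 0"
  unfolding infsum_dual_lattice[OF assms, symmetric]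
  by (intro infsum_nonneg prod_nonneg) (use n in \<open>auto simp: zero_le_even_power\<close>)

text \<open>Nonnegative discrete cosine coefficients modulo \<open>N\<close>. Asking for every
  frequency \<open>r\<close>, not only \<open>r = 0\<close>, is what makes the class closed under
  multiplication by cosines.\<close>

definition cos_positive :: "nat \<Rightarrow> (nat \<Rightarrow> real) \<Rightarrow> bool" where
  "cos_positive N g \<longleftrightarrow> (\<forall>r::int. 0 \<le> (\<Sum>n<N. g n * cos (2 * pi * of_int r * real n / real N)))"

lemma cos_positive_1: "N > 0 \<Longrightarrow> cos_positive N (\<lambda>n. 1)"
  using sum_cos_root_of_unity[of N 0] by (simp add: cos_positive_def)

lemma cos_positive_sum_nonneg: "cos_positive N g \<Longrightarrow> 0 \<le> (\<Sum>n<N. g n)"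
  unfolding cos_positive_def by (drule spec[of _ 0]) simp

text \<open>By the product-to-sum formula the new coefficient at \<open>r\<close> is the average of
  the old ones at \<open>h * k - r\<close> and \<open>h * k + r\<close>.\<close>

lemma cos_positive_times_cos:
  assumes g: "cos_positive N g"
  shows "cos_positive N (\<lambda>n. g n * cos (2 * pi * real h * (real n * real k / real N)))"
  unfolding cos_positive_def
proof
  fix r :: int
  let ?c = "\<lambda>r n. cos (2 * pi * of_int r * real n / real N)"
  have "g n * cos (2 * pi * real h * (real n * real k / real N)) * ?c r n =
      1 / 2 * (g n * ?c (int (h * k) - r) n + g n * ?c (int (h * k) + r) n)" for n
  proof -
    have "2 * pi * of_int (int (h * k) - r) * real n / real N =
        2 * pi * real h * (real n * real k / real N) - 2 * pi * of_int r * real n / real N"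
      "2 * pi * of_int (int (h * k) + r) * real n / real N =
        2 * pi * real h * (real n * real k / real N) + 2 * pi * of_int r * real n / real N"
      by (simp_all add: algebra_simps diff_divide_distrib add_divide_distrib)
    then show ?thesis
      unfolding mult.assoc cos_times_cos by (simp only: ) (simp add: distrib_left)
  qed
  then have "(\<Sum>n<N. g n * cos (2 * pi * real h * (real n * real k / real N)) * ?c r n) =
      1 / 2 * ((\<Sum>n<N. g n * ?c (int (h * k) - r) n) + (\<Sum>n<N. g n * ?c (int (h * k) + r) n))"
    by (simp add: sum_distrib_left sum.distrib distrib_left)
  moreover have "0 \<le> (\<Sum>n<N. g n * ?c r n)" for r
    using g unfolding cos_positive_def by blast
  ultimately show "0 \<le> (\<Sum>n<N. g n * cos (2 * pi * real h * (real n * real k / real N)) * ?c r n)"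
    by (simp only: add_nonneg_nonneg zero_le_mult_iff zero_le_divide_1_iff zero_le_numeral simp_thms)
qed

lemma cos_positive_times_cos_series:
  assumes g: "cos_positive N g" and p: "p \<ge> 2"
  shows "cos_positive N (\<lambda>n. g n * cos_series p (real n * real k / real N))"
  unfolding cos_positive_def
proof
  fix r :: int
  let ?c = "\<lambda>n. cos (2 * pi * of_int r * real n / real N)"
  let ?t = "\<lambda>h n. cos (2 * pi * real (Suc h) * (real n * real k / real N))"
  have S: "(\<lambda>h. \<Sum>n<N. g n * (2 * ?t h n / real (Suc h) ^ p) * ?c n) sums
      (\<Sum>n<N. g n * cos_series p (real n * real k / real N) * ?c n)"
    by (intro sums_sum sums_mult2 sums_mult cos_series_sums p)
  have nonneg: "0 \<le> (\<Sum>n<N. g n * (2 * ?t h n / real (Suc h) ^ p) * ?c n)" for h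
  proof -
    have "(\<Sum>n<N. g n * (2 * ?t h n / real (Suc h) ^ p) * ?c n) =
        2 / real (Suc h) ^ p * (\<Sum>n<N. g n * ?t h n * ?c n)"
      by (simp add: sum_distrib_left mult_ac del: of_nat_Suc)
    moreover have "0 \<le> (\<Sum>n<N. g n * ?t h n * ?c n)"
      using cos_positive_times_cos[OF g, of "Suc h" k] unfolding cos_positive_def by blast
    ultimately show ?thesis by (simp del: of_nat_Suc)
  qed
  show "0 \<le> (\<Sum>n<N. g n * cos_series p (real n * real k / real N) * ?c n)"
    by (rule sums_le[OF nonneg sums_zero S])
qed

text \<open>What reflecting the arguments leaves of the Bernoulli term of degree
  \<open>2 * p\<close>, up to a constant; it is the \<open>E\<close> of the overview.\<close>

definition cos_pair :: "nat \<Rightarrow> real \<Rightarrow> real \<Rightarrow> real" where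
  "cos_pair p x y = (cos_series (2 * p) (x - y) + cos_series (2 * p) (x + y)) / 2"

text \<open>The coefficient is kept as a square to display it as the square of
  \<open>1 / real (Suc h) ^ p\<close>, which occurs in \<open>cos_series p\<close>.\<close>

lemma cos_pair_sums:
  assumes "p \<ge> 2"
  shows "(\<lambda>h. 2 * (1 / real (Suc h) ^ p)\<^sup>2 * (cos (2 * pi * real (Suc h) * x) * cos (2 * pi * real (Suc h) * y)))
    sums cos_pair p x y"
proof -
  have p: "2 * p \<ge> 2" using assms by simp
  have "2 * (1 / real (Suc h) ^ p)\<^sup>2 * (cos (2 * pi * real (Suc h) * x) * cos (2 * pi * real (Suc h) * y)) =
    (2 * cos (2 * pi * real (Suc h) * (x - y)) / real (Suc h) ^ (2 * p)
      + 2 * cos (2 * pi * real (Suc h) * (x + y)) / real (Suc h) ^ (2 * p)) / 2" for h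
  proof -
    have *: "(1 / real (Suc h) ^ p)\<^sup>2 = 1 / real (Suc h) ^ (2 * p)"
      by (simp only: power_one_over power_mult [symmetric] mult.commute[of p 2] flip: power_divide)
    show ?thesis
      unfolding cos_times_cos * by (simp add: right_diff_distrib distrib_left add_divide_distrib del: of_nat_Suc)
  qed
  then show ?thesis
    unfolding cos_pair_def by (simp only:) (intro sums_divide sums_add cos_series_sums p)
qed

lemma cos_positive_times_prod_cos_series:
  assumes "cos_positive N g" "p \<ge> 2" "finite u"
  shows "cos_positive N (\<lambda>n. g n * (\<Prod>j\<in>u. cos_series p (real n * real (k j) / real N)))"
  using assms(3,1)
proof (induction u arbitrary: g rule: finite_induct)
  case (insert i u)
  from insert.IH[OF cos_positive_times_cos_series[OF insert.prems assms(2), of "k i"]]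
  show ?case using insert.hyps by (simp add: mult.assoc)
qed simp

text \<open>Expanding the factor \<open>cos_pair\<close> of one coordinate into its cosine series turns the double sum into
  a series of double sums of the same shape with \<open>g\<close> multiplied by a cosine. The terms \<open>b h\<close> of the
  corresponding expansion of the right-hand side are nonnegative, so that the sum of their squares is at
  most the square of their sum.\<close>

lemma double_sum_prod_cos_le:
  fixes k :: "'a \<Rightarrow> nat" and N p :: nat
  defines "x \<equiv> \<lambda>j n. real n * real (k j) / real N"
  assumes p: "p \<ge> 2" and "finite u" and "cos_positive N g"
  shows "(\<Sum>n<N. \<Sum>m<N. g n * g m * (\<Prod>j\<in>u. cos_series p (x j n) * cos_series p (x j m) + cos_pair p (x j n) (x j m)))
    \<le> (3 / 2) ^ card u * (\<Sum>n<N. g n * (\<Prod>j\<in>u. cos_series p (x j n)))\<^sup>2"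
  using assms(3,4)
proof (induction u arbitrary: g rule: finite_induct)
  case empty
  then show ?case by (simp add: power2_eq_square sum_product)
next
  case (insert i u)
  define T where "T n m = (\<Prod>j\<in>u. cos_series p (x j n) * cos_series p (x j m) + cos_pair p (x j n) (x j m))" for n m
  define R where "R n = (\<Prod>j\<in>u. cos_series p (x j n))" for n
  define C where "C = (\<lambda>n. cos_series p (x i n))"
  define c where "c h n = cos (2 * pi * real (Suc h) * x i n)" for h n
  define a where "a h = 1 / real (Suc h) ^ p" for h
  define Q where "Q = (\<Sum>n<N. g n * C n * R n)"
  define q where "q h = (\<Sum>n<N. g n * c h n * R n)" for h
  define \<kappa> :: real where "\<kappa> = (3 / 2) ^ card u"
  have IH: "(\<Sum>n<N. \<Sum>m<N. f n * f m * T n m) \<le> \<kappa> * (\<Sum>n<N. f n * R n)\<^sup>2"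
    if "cos_positive N f" for f
    unfolding T_def R_def \<kappa>_def by (rule insert.IH[OF that])
  have gC: "cos_positive N (\<lambda>n. g n * C n)"
    unfolding C_def x_def by (rule cos_positive_times_cos_series[OF insert.prems p])
  have gc: "cos_positive N (\<lambda>n. g n * c h n)" for h
    unfolding c_def x_def by (rule cos_positive_times_cos[OF insert.prems])
  have q_nonneg: "q h \<ge> 0" for h
    using cos_positive_sum_nonneg[OF cos_positive_times_prod_cos_series[OF gc p insert.hyps(1), of h k]]
    by (simp add: q_def R_def x_def)
  have a_pos: "a h > 0" for h by (simp add: a_def)
  have \<kappa>: "\<kappa> \<ge> 0" by (simp add: \<kappa>_def)
  define b where "b h = 2 * a h * q h" for h
  have b_nonneg: "b h \<ge> 0" for h
    using a_pos[of h] q_nonneg[of h] by (simp add: b_def)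
  have b_sums: "b sums Q"
  proof -
    have "(\<lambda>h. \<Sum>n<N. g n * (2 * cos (2 * pi * real (Suc h) * x i n) / real (Suc h) ^ p) * R n) sums Q"
      unfolding Q_def C_def by (intro sums_sum sums_mult2 sums_mult cos_series_sums p)
    also have "(\<lambda>h. \<Sum>n<N. g n * (2 * cos (2 * pi * real (Suc h) * x i n) / real (Suc h) ^ p) * R n) = b"
      by (rule ext, unfold b_def a_def q_def c_def sum_distrib_left, rule sum.cong) simp_all
    finally show ?thesis .
  qed
  have b_le: "b h \<le> Q" for h
    using sum_le_suminf[OF sums_summable[OF b_sums], of "{h}"] b_nonneg sums_unique[OF b_sums] by simp
  define B where "B = (\<Sum>n<N. \<Sum>m<N. g n * g m * cos_pair p (x i n) (x i m) * T n m)"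
  define F where "F h = 2 * (a h)\<^sup>2 * (\<Sum>n<N. \<Sum>m<N. (g n * c h n) * (g m * c h m) * T n m)" for h
  have F_sums: "F sums B"
  proof -
    have "(\<lambda>h. \<Sum>n<N. \<Sum>m<N. g n * g m * (2 * (1 / real (Suc h) ^ p)\<^sup>2 *
      (cos (2 * pi * real (Suc h) * x i n) * cos (2 * pi * real (Suc h) * x i m))) * T n m) sums B"
      unfolding B_def by (intro sums_sum sums_mult2 sums_mult cos_pair_sums p)
    also have "(\<lambda>h. \<Sum>n<N. \<Sum>m<N. g n * g m * (2 * (1 / real (Suc h) ^ p)\<^sup>2 *
      (cos (2 * pi * real (Suc h) * x i n) * cos (2 * pi * real (Suc h) * x i m))) * T n m) = F"
      by (rule ext, unfold F_def a_def c_def sum_distrib_left, intro sum.cong refl) (simp only: mult_ac)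
    finally show ?thesis .
  qed
  \<comment> \<open>\<open>b h\<close> carries the factor 2 of the pair \<open>h\<close>,
    \<open>-h\<close>, so \<open>2 * (a h)^2 * (q h)^2\<close> is half of its square. Replacing one
    factor \<open>b h\<close> by its bound \<open>Q\<close> leaves a series in \<open>h\<close> with
    the known sum \<open>Q\<close>.\<close>
  have F_le: "F h \<le> \<kappa> / 2 * Q * b h" for h
  proof -
    have "F h \<le> 2 * (a h)\<^sup>2 * (\<kappa> * (q h)\<^sup>2)"
      unfolding F_def q_def by (intro mult_left_mono IH gc) simp
    also have "\<dots> = \<kappa> / 2 * (b h * b h)"
      by (simp add: b_def power2_eq_square)
    also have "\<dots> \<le> \<kappa> / 2 * (Q * b h)"
      using \<kappa> b_le b_nonneg by (intro mult_left_mono mult_right_mono) auto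
    finally show ?thesis by simp
  qed
  have B_le: "B \<le> \<kappa> / 2 * Q * Q"
    by (rule sums_le[OF F_le F_sums]) (intro sums_mult b_sums)
  have A_le: "(\<Sum>n<N. \<Sum>m<N. (g n * C n) * (g m * C m) * T n m) \<le> \<kappa> * Q\<^sup>2"
    using IH[OF gC] by (simp add: Q_def)
  have lhs: "(\<Sum>n<N. \<Sum>m<N. g n * g m *
      (\<Prod>j\<in>insert i u. cos_series p (x j n) * cos_series p (x j m) + cos_pair p (x j n) (x j m))) =
      (\<Sum>n<N. \<Sum>m<N. (g n * C n) * (g m * C m) * T n m) + B"
    unfolding B_def sum.distrib[symmetric] using insert.hyps
    by (intro sum.cong refl) (simp add: T_def C_def algebra_simps)
  have Q: "(\<Sum>n<N. g n * (\<Prod>j\<in>insert i u. cos_series p (x j n))) = Q"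
    unfolding Q_def C_def R_def using insert.hyps by (simp add: mult.assoc)
  have rhs: "(3 / 2) ^ card (insert i u) * Q\<^sup>2 = \<kappa> * Q\<^sup>2 + \<kappa> / 2 * Q * Q"
    using insert.hyps by (simp add: \<kappa>_def power2_eq_square)
  show ?case
    unfolding lhs Q rhs using A_le B_le by linarith
qed

section \<open>Cosine form of the one-dimensional Sobolev kernel\<close>

lemma cos_series_abs: "cos_series n \<bar>x\<bar> = cos_series n x"
  by (simp add: abs_if cos_series_minus)

text \<open>As \<open>\<alpha>\<close> is even, the Bernoulli sum has a single term of even degree.
  Its sign \<open>(-1) ^ m\<close> occurs twice and cancels; in degree \<open>2 * \<alpha>\<close>
  the Fourier formula gives -1, which cancels the -1 of the kernel.\<close>

lemma sob_kernel_1_eq: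
  assumes \<alpha>: "even \<alpha>" "\<alpha> > 0" and x: "x \<in> {0..1}" and y: "y \<in> {0..1}"
  shows "- 1 + sob_kernel_1 \<alpha> x y =
    (\<Sum>\<tau>\<in>{\<tau>. odd \<tau> \<and> \<tau> < \<alpha>}. bernpoly \<tau> x * bernpoly \<tau> y / (fact \<tau>)\<^sup>2) +
    (cos_series \<alpha> x * cos_series \<alpha> y + cos_series (2 * \<alpha>) (x - y)) / (2 * pi) ^ (2 * \<alpha>)"
proof -
  have set: "{\<tau>. 1 \<le> \<tau> \<and> \<tau> \<le> \<alpha> \<and> (odd \<tau> \<or> \<tau> = \<alpha>)} = insert \<alpha> {\<tau>. odd \<tau> \<and> \<tau> < \<alpha>}"
    using \<alpha> by (auto simp: Suc_le_eq odd_pos)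
  have "finite {\<tau>. odd \<tau> \<and> \<tau> < \<alpha>}" by simp
  then have sum: "(\<Sum>\<tau>\<in>{\<tau>. 1 \<le> \<tau> \<and> \<tau> \<le> \<alpha> \<and> (odd \<tau> \<or> \<tau> = \<alpha>)}. bernpoly \<tau> x * bernpoly \<tau> y / (fact \<tau>)\<^sup>2) =
      bernpoly \<alpha> x * bernpoly \<alpha> y / (fact \<alpha>)\<^sup>2 +
      (\<Sum>\<tau>\<in>{\<tau>. odd \<tau> \<and> \<tau> < \<alpha>}. bernpoly \<tau> x * bernpoly \<tau> y / (fact \<tau>)\<^sup>2)"
    unfolding set by (subst sum.insert) auto
  obtain m where m: "\<alpha> = 2 * m" using \<alpha>(1) by (rule evenE)
  define s :: real where "s = (-1) ^ m"
  have s: "s * s = 1" by (simp add: s_def flip: power_mult_distrib)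
  have "bernpoly \<alpha> t = - s * fact \<alpha> / (2 * pi) ^ \<alpha> * cos_series \<alpha> t" if "t \<in> {0..1}" for t
    using bernpoly_eq_cos_series[of m t] \<alpha>(2) that unfolding m s_def by simp
  note b = this[OF x] this[OF y]
  have scale: "(- s * F / P * c) * (- s * F / P * d) / F\<^sup>2 = (s * s) * (c * d / (P * P))" if "F \<noteq> 0" for c d F P :: real
    using that by (simp add: power2_eq_square)
  have "bernpoly \<alpha> x * bernpoly \<alpha> y / (fact \<alpha>)\<^sup>2 =
     (s * s) * (cos_series \<alpha> x * cos_series \<alpha> y / ((2 * pi) ^ \<alpha> * (2 * pi) ^ \<alpha>))"
    unfolding b by (rule scale) simp
  then have prod: "bernpoly \<alpha> x * bernpoly \<alpha> y / (fact \<alpha>)\<^sup>2 =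
     cos_series \<alpha> x * cos_series \<alpha> y / (2 * pi) ^ (2 * \<alpha>)"
    unfolding s by (simp only: mult_1 mult_2[of \<alpha>] power_add)
  have "\<bar>x - y\<bar> \<in> {0..1}" using x y by auto
  then have "bernpoly (2 * \<alpha>) \<bar>x - y\<bar> = - fact (2 * \<alpha>) / (2 * pi) ^ (2 * \<alpha>) * cos_series (2 * \<alpha>) (x - y)"
    using bernpoly_eq_cos_series[OF \<alpha>(2)] \<alpha>(1) by (simp only: cos_series_abs neg_one_even_power)
  then have "(-1) ^ (\<alpha> + 1) * bernpoly (2 * \<alpha>) \<bar>x - y\<bar> / fact (2 * \<alpha>) =
      cos_series (2 * \<alpha>) (x - y) / (2 * pi) ^ (2 * \<alpha>)"
    using \<alpha>(1) by simp
  then show ?thesis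
    unfolding sob_kernel_1_def sum prod by (simp add: add_divide_distrib)
qed

text \<open>Each reflection flips the sign of the odd part \<open>W\<close>, so its four copies
  cancel. The product of cosine series is invariant, and the last term alternates between the
  arguments \<open>x - y\<close> and \<open>x + y\<close> by periodicity.\<close>

lemma sym_kernel_sob_kernel_1:
  assumes \<alpha>: "even \<alpha>" "\<alpha> > 0" and x: "x \<in> {0..1}" and y: "y \<in> {0..1}"
  shows "sym_kernel (\<lambda>x y. - 1 + sob_kernel_1 \<alpha> x y) x y =
    (cos_series \<alpha> x * cos_series \<alpha> y + cos_pair \<alpha> x y) / (2 * pi) ^ (2 * \<alpha>)"
proof -
  define W where "W x y = (\<Sum>\<tau>\<in>{\<tau>. odd \<tau> \<and> \<tau> < \<alpha>}. bernpoly \<tau> x * bernpoly \<tau> y / (fact \<tau>)\<^sup>2)" for x y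
  have W: "W x (1 - y) = - W x y" "W (1 - x) y = - W x y" for x y
    unfolding W_def sum_negf[symmetric] by (intro sum.cong; simp add: bernpoly_reflect)+
  have x': "1 - x \<in> {0..1}" and y': "1 - y \<in> {0..1}" using x y by auto
  have "x - (1 - y) = x + y + of_int (- 1)" "1 - x - y = 1 - (x + y)" "1 - x - (1 - y) = - (x - y)"
    by simp_all
  then have shift: "cos_series n (x - (1 - y)) = cos_series n (x + y)"
    "cos_series n (1 - x - y) = cos_series n (x + y)"
    "cos_series n (1 - x - (1 - y)) = cos_series n (x - y)" for n
    by (simp_all only: cos_series_add_int cos_series_one_minus cos_series_minus)
  note eq = sob_kernel_1_eq[OF \<alpha>, folded W_def]
  have mean: "(w + (c + a) / d + (- w + (c + b) / d) + (- w + (c + b) / d) + (- (- w) + (c + a) / d)) / 4 =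
      (c + (a + b) / 2) / d" for a b c d w :: real
    by (simp add: add_divide_distrib)
  show ?thesis
    unfolding sym_kernel_def eq[OF x y] eq[OF x y'] eq[OF x' y] eq[OF x' y'] W shift
      cos_series_one_minus cos_pair_def
    by (rule mean)
qed

text \<open>The odd part has midpoint mean exactly 0, and the two series are left with their tails.
  The factor \<open>cos_tail \<alpha> 0\<close> is the uniform bound for
  \<open>cos_series \<alpha> x\<close>.\<close>

lemma abs_midpoint_mean_sob_kernel_1_le:
  assumes \<alpha>: "even \<alpha>" "\<alpha> > 0" and M: "M > 0" and x: "x \<in> {0..1}"
  shows "\<bar>midpoint_mean M (\<lambda>y. - 1 + sob_kernel_1 \<alpha> x y)\<bar> \<le>
    (cos_tail \<alpha> 0 * cos_tail \<alpha> M + cos_tail (2 * \<alpha>) M) / (2 * pi) ^ (2 * \<alpha>)"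
proof -
  have n: "\<alpha> \<ge> 2" "2 * \<alpha> \<ge> 2" using \<alpha> by (auto elim: evenE)
  let ?w = "1 / (2 * pi) ^ (2 * \<alpha>)"
  have "midpoint_mean M (\<lambda>y. - 1 + sob_kernel_1 \<alpha> x y) =
    midpoint_mean M (\<lambda>y. (\<Sum>\<tau>\<in>{\<tau>. odd \<tau> \<and> \<tau> < \<alpha>}. bernpoly \<tau> x / (fact \<tau>)\<^sup>2 * bernpoly \<tau> y) +
      ?w * (cos_series \<alpha> x * cos_series \<alpha> y + cos_series (2 * \<alpha>) (x - y)))"
    by (rule midpoint_mean_cong) (subst sob_kernel_1_eq[OF \<alpha> x], auto)
  also have "\<dots> = (\<Sum>\<tau>\<in>{\<tau>. odd \<tau> \<and> \<tau> < \<alpha>}. bernpoly \<tau> x / (fact \<tau>)\<^sup>2 * midpoint_mean M (bernpoly \<tau>)) +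
      ?w * (cos_series \<alpha> x * midpoint_mean M (cos_series \<alpha>) + midpoint_mean M (\<lambda>y. cos_series (2 * \<alpha>) (x - y)))"
    by (simp only: midpoint_mean_add midpoint_mean_cmult midpoint_mean_sum)
  also have "(\<Sum>\<tau>\<in>{\<tau>. odd \<tau> \<and> \<tau> < \<alpha>}. bernpoly \<tau> x / (fact \<tau>)\<^sup>2 * midpoint_mean M (bernpoly \<tau>)) = 0"
    by (intro sum.neutral) (auto intro!: midpoint_mean_antisymmetric simp: bernpoly_reflect)
  finally have eq: "midpoint_mean M (\<lambda>y. - 1 + sob_kernel_1 \<alpha> x y) =
    ?w * (cos_series \<alpha> x * midpoint_mean M (cos_series \<alpha>) + midpoint_mean M (\<lambda>y. cos_series (2 * \<alpha>) (x - y)))"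
    by simp
  have "\<bar>midpoint_mean M (cos_series \<alpha>)\<bar> \<le> cos_tail \<alpha> M"
    using abs_midpoint_mean_cos_series_le[OF n(1) M, of 0] by (simp add: cos_series_minus)
  then have "\<bar>cos_series \<alpha> x * midpoint_mean M (cos_series \<alpha>)\<bar> \<le> cos_tail \<alpha> 0 * cos_tail \<alpha> M"
    unfolding abs_mult using abs_cos_series_le[OF n(1), of x] by (intro mult_mono) auto
  moreover have "\<bar>midpoint_mean M (\<lambda>y. cos_series (2 * \<alpha>) (x - y))\<bar> \<le> cos_tail (2 * \<alpha>) M"
    by (rule abs_midpoint_mean_cos_series_le[OF n(2) M])
  ultimately have "\<bar>cos_series \<alpha> x * midpoint_mean M (cos_series \<alpha>) + midpoint_mean M (\<lambda>y. cos_series (2 * \<alpha>) (x - y))\<bar>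
    \<le> cos_tail \<alpha> 0 * cos_tail \<alpha> M + cos_tail (2 * \<alpha>) M" by linarith
  then show ?thesis unfolding eq abs_mult by (simp add: divide_right_mono)
qed

section \<open>Worst-case errors\<close>

lemma cos_series_frac_diff: "cos_series n (frac x - frac y) = cos_series n (x - y)"
  using cos_series_add_int[of n "frac x - frac y" "\<lfloor>x\<rfloor> - \<lfloor>y\<rfloor>"] by (simp add: frac_def)

lemma cos_series_frac_add: "cos_series n (frac x + frac y) = cos_series n (x + y)"
  using cos_series_add_int[of n "frac x + frac y" "\<lfloor>x\<rfloor> + \<lfloor>y\<rfloor>"] by (simp add: frac_def)

lemma cos_pair_frac: "cos_pair p (frac x) (frac y) = cos_pair p x y"
  by (simp add: cos_pair_def cos_series_frac_diff cos_series_frac_add)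

lemma sob_kernel_eq_weighted_kernel:
  "sob_kernel \<alpha> w = weighted_kernel w (\<lambda>x y. - 1 + sob_kernel_1 \<alpha> x y)"
  by (simp add: fun_eq_iff sob_kernel_def weighted_kernel_def)

lemma kor_kernel_eq_weighted_kernel:
  assumes n: "n \<ge> 2" "even n"
  shows "kor_kernel (real n / 2) w = weighted_kernel w (\<lambda>x y. cos_series n (x - y))"
proof -
  have "(\<Sum>\<^sub>\<infinity>h\<in>UNIV - {0::int}. exp (2 * of_real pi * \<i> * of_int h * of_real t)
      / of_real (\<bar>of_int h\<bar> powr (2 * (real n / 2)))) = complex_of_real (cos_series n t)" for t
  proof -
    have "exp (2 * of_real pi * \<i> * of_int h * of_real t) / of_real (\<bar>of_int h\<bar> powr (2 * (real n / 2))) =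
        cis (2 * pi * of_int h * t) / of_int h ^ n" if "h \<noteq> 0" for h :: int
    proof -
      have "\<bar>real_of_int h\<bar> powr (2 * (real n / 2)) = of_int h ^ n"
        using that n(2) by (simp add: powr_realpow power_even_abs)
      then show ?thesis by (simp add: cis_conv_exp mult_ac)
    qed
    then have "(\<Sum>\<^sub>\<infinity>h\<in>UNIV - {0::int}. exp (2 * of_real pi * \<i> * of_int h * of_real t)
        / of_real (\<bar>of_int h\<bar> powr (2 * (real n / 2)))) =
      (\<Sum>\<^sub>\<infinity>h\<in>UNIV - {0::int}. cis (2 * pi * of_int h * t) / of_int h ^ n)"
      by (intro infsum_cong) auto
    then show ?thesis using infsumI[OF has_sum_cis_power[OF n]] by simp
  qed
  then show ?thesis
    by (intro ext) (simp only: kor_kernel_def weighted_kernel_def Re_complex_of_real)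
qed

text \<open>The map \<open>m\<close> to \<open>(n - m) mod N\<close> is an involution of the
  residues.\<close>

lemma sum_periodic_reflect:
  fixes f :: "int \<Rightarrow> real"
  assumes N: "N > 0" and f: "\<And>i. f (i mod int N) = f i"
  shows "(\<Sum>m<N. f (int n - int m)) = (\<Sum>m<N. f (int m))"
proof -
  let ?r = "\<lambda>m. nat ((int n - int m) mod int N)"
  have r: "int (?r m) = (int n - int m) mod int N" for m using N by simp
  have inv: "?r (?r m) = m" if "m < N" for m
  proof -
    have "(int n - int (?r m)) mod int N = int m mod int N"
      unfolding r by (simp add: mod_diff_right_eq)
    then show ?thesis using that by simp
  qed
  have less: "?r m < N" for m using N by (simp add: nat_less_iff)
  show ?thesis
  proof (rule sum.reindex_bij_witness[where i = ?r and j = ?r])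
    fix m
    show "f (int (?r m)) = f (int n - int m)" unfolding r by (rule f)
  qed (use inv less in auto)
qed

text \<open>Modulo 1 the lattice points form a group, so for a fixed point the differences run
  through the lattice again and the double mean collapses to a single one.\<close>

lemma mset_mean_lattice_points_cos_series_diff:
  fixes z :: "nat ^ 's"
  assumes N: "N > 0"
  shows "mset_mean (lattice_points N z) (\<lambda>x. mset_mean (lattice_points N z)
      (\<lambda>y. \<Prod>j\<in>u. cos_series n (x $ j - y $ j))) = cos_product_mean n N z u"
proof -
  define f where "f i = (\<Prod>j\<in>u. cos_series n (of_int i * real (z $ j) / real N))" for i :: int
  have periodic: "f (i mod int N) = f i" for i
  proof -
    have "cos_series n (of_int (i mod int N) * real (z $ j) / real N) =
        cos_series n (of_int i * real (z $ j) / real N)" for j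
    proof -
      have "real_of_int i = of_int (i mod int N) + of_int (i div int N) * real N"
        by (metis add.commute div_mult_mod_eq of_int_add of_int_mult of_int_of_nat_eq)
      then have "of_int i * real (z $ j) / real N =
          of_int (i mod int N) * real (z $ j) / real N + of_int (i div int N * int (z $ j))"
        using N by (simp add: field_simps)
      then show ?thesis by (simp only: cos_series_add_int)
    qed
    then show ?thesis by (simp add: f_def)
  qed
  note reflect = sum_periodic_reflect[of N f, OF N periodic]
  have "cos_series n (frac (real m * real (z $ j) / real N) - frac (real k * real (z $ j) / real N)) =
      cos_series n (of_int (int m - int k) * real (z $ j) / real N)" for m k j
    by (simp add: cos_series_frac_diff left_diff_distrib diff_divide_distrib)
  then have "mset_mean (lattice_points N z) (\<lambda>x. mset_mean (lattice_points N z)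
      (\<lambda>y. \<Prod>j\<in>u. cos_series n (x $ j - y $ j))) = (\<Sum>m<N. (\<Sum>k<N. f (int m - int k)) / real N) / real N"
    by (simp add: mset_mean_lattice_points lattice_point_def f_def)
  also have "\<dots> = cos_product_mean n N z u"
    unfolding reflect using N by (simp add: cos_product_mean_def f_def)
  finally show ?thesis .
qed

lemma mset_mean_sym_kernel_sob_kernel_1_le:
  fixes z :: "nat ^ 's"
  assumes \<alpha>: "even \<alpha>" "\<alpha> > 0" and N: "N > 0"
  shows "mset_mean (lattice_points N z) (\<lambda>x. mset_mean (lattice_points N z)
      (\<lambda>y. \<Prod>j\<in>u. sym_kernel (\<lambda>x y. - 1 + sob_kernel_1 \<alpha> x y) (x $ j) (y $ j)))
    \<le> (3 / (2 ^ (2 * \<alpha> + 1) * pi ^ (2 * \<alpha>))) ^ card u * (cos_product_mean \<alpha> N z u)\<^sup>2"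
proof -
  have p: "\<alpha> \<ge> 2" using \<alpha> by (auto elim: evenE)
  let ?x = "\<lambda>j n. real n * real (z $ j) / real N"
  let ?w = "1 / (2 * pi) ^ (2 * \<alpha>)"
  have sym: "sym_kernel (\<lambda>x y. - 1 + sob_kernel_1 \<alpha> x y) (lattice_point N z n $ j) (lattice_point N z m $ j) =
      ?w * (cos_series \<alpha> (?x j n) * cos_series \<alpha> (?x j m) + cos_pair \<alpha> (?x j n) (?x j m))" for n m j
  proof -
    have frac: "frac t \<in> {0..1}" for t :: real by (simp add: frac_lt_1 less_imp_le)
    show ?thesis
      unfolding lattice_point_def vec_lambda_beta sym_kernel_sob_kernel_1[OF \<alpha> frac frac]
        cos_series_frac cos_pair_frac by simp
  qed
  \<comment> \<open>The factors \<open>1 * 1\<close> are the constant weight \<open>g\<close> with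
    which \<open>double_sum_prod_cos_le\<close> is applied.\<close>
  have "mset_mean (lattice_points N z) (\<lambda>x. mset_mean (lattice_points N z)
      (\<lambda>y. \<Prod>j\<in>u. sym_kernel (\<lambda>x y. - 1 + sob_kernel_1 \<alpha> x y) (x $ j) (y $ j))) =
    ?w ^ card u / (real N)\<^sup>2 * (\<Sum>n<N. \<Sum>m<N. 1 * 1 *
      (\<Prod>j\<in>u. cos_series \<alpha> (?x j n) * cos_series \<alpha> (?x j m) + cos_pair \<alpha> (?x j n) (?x j m)))"
    unfolding mset_mean_lattice_points sym prod.distrib
    by (simp only: prod_constant sum_distrib_left sum_divide_distrib power2_eq_square) (simp add: field_simps)
  also have "\<dots> \<le> ?w ^ card u / (real N)\<^sup>2 * ((3 / 2) ^ card u * (\<Sum>n<N. 1 * (\<Prod>j\<in>u. cos_series \<alpha> (?x j n)))\<^sup>2)"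
    by (intro mult_left_mono double_sum_prod_cos_le p cos_positive_1 N) auto
  also have "\<dots> = (?w * (3 / 2)) ^ card u * (cos_product_mean \<alpha> N z u)\<^sup>2"
    by (simp add: cos_product_mean_def power_mult_distrib power_divide)
  \<comment> \<open>Here \<open>3 / 2\<close> per coordinate meets the normalisation
    \<open>(2 * pi) ^ (2 * \<alpha>)\<close> and becomes the constant of
    \<open>scaled_weights\<close>.\<close>
  also have "?w * (3 / 2) = 3 / (2 ^ (2 * \<alpha> + 1) * pi ^ (2 * \<alpha>))"
    by (simp add: power_mult_distrib)
  finally show ?thesis .
qed

lemma wor_error_sob_squared:
  fixes z :: "nat ^ 's"
  assumes \<alpha>: "even \<alpha>" "\<alpha> > 0" and N: "N > 0"
    and H: "rkhs (cbox 0 1) (sob_kernel \<alpha> \<gamma>) H ip"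
  shows "(wor_error (sym_lattice_points N z) H (fun_norm ip))\<^sup>2 =
    ereal (\<Sum>u\<in>{u. u \<noteq> {}}. \<gamma> u * mset_mean (lattice_points N z) (\<lambda>x. mset_mean (lattice_points N z)
      (\<lambda>y. \<Prod>j\<in>u. sym_kernel (\<lambda>x y. - 1 + sob_kernel_1 \<alpha> x y) (x $ j) (y $ j))))"
proof -
  have n: "\<alpha> \<ge> 2" "2 * \<alpha> \<ge> 2" using \<alpha> by (auto elim: evenE)
  let ?k = "\<lambda>x y. - 1 + sob_kernel_1 \<alpha> x y"
  let ?t = "\<lambda>M. (cos_tail \<alpha> 0 * cos_tail \<alpha> M + cos_tail (2 * \<alpha>) M) / (2 * pi) ^ (2 * \<alpha>)"
  have "?t \<longlonglongrightarrow> (cos_tail \<alpha> 0 * 0 + 0) / (2 * pi) ^ (2 * \<alpha>)"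
    by (intro tendsto_intros cos_tail_tendsto_0 n) simp
  then have "?t \<longlonglongrightarrow> 0" by simp
  then have lim: "uniform_limit (cbox 0 1) (\<lambda>M x. mset_mean (midpoint_grid M) (weighted_kernel \<gamma> ?k x))
      (\<lambda>x. 1) sequentially"
    by (intro uniform_limit_weighted_kernel[where t = ?t] abs_midpoint_mean_sob_kernel_1_le[OF \<alpha>])
  have "continuous_on ({0..1} \<times> {0..1}) (\<lambda>p. ?k (fst p) (snd p))"
    unfolding sob_kernel_1_def by (intro continuous_intros) auto
  then have cont: "continuous_on (cbox 0 1 \<times> cbox 0 1) (\<lambda>p. weighted_kernel \<gamma> ?k (fst p) (snd p))"
    by (rule continuous_on_weighted_kernel)
  note P = sym_lattice_points_nonempty[OF N, of z]
  show ?thesis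
    using rkhs_wor_error_squared[OF H[unfolded sob_kernel_eq_weighted_kernel] cont lim P set_sym_lattice_points]
    unfolding mset_mean_mset_mean_weighted_kernel[OF P] mset_mean_sym_lattice_points_prod_kernel[where k = ?k]
    by (simp only: add_diff_cancel_left')
qed

lemma wor_error_kor_squared:
  fixes z :: "nat ^ 's"
  assumes n: "n \<ge> 2" "even n" and N: "N > 0"
    and H: "rkhs (cbox 0 1) (kor_kernel (real n / 2) w) H ip"
  shows "(wor_error (lattice_points N z) H (fun_norm ip))\<^sup>2 =
    ereal (\<Sum>u\<in>{u. u \<noteq> {}}. w u * cos_product_mean n N z u)"
proof -
  let ?k = "\<lambda>x y. cos_series n (x - y)"
  have lim: "uniform_limit (cbox 0 1) (\<lambda>M x. mset_mean (midpoint_grid M) (weighted_kernel w ?k x))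
      (\<lambda>x. 1) sequentially"
    by (intro uniform_limit_weighted_kernel[where t = "cos_tail n"] abs_midpoint_mean_cos_series_le
        cos_tail_tendsto_0 n)
  have "continuous_on ({0..1} \<times> {0..1}) (\<lambda>p. ?k (fst p) (snd p))"
    by (rule continuous_on_compose2[OF continuous_on_cos_series[OF n(1), of UNIV]])
      (auto intro!: continuous_intros)
  then have cont: "continuous_on (cbox 0 1 \<times> cbox 0 1) (\<lambda>p. weighted_kernel w ?k (fst p) (snd p))"
    by (rule continuous_on_weighted_kernel)
  note P = lattice_points_nonempty[OF N, of z]
  show ?thesis
    using rkhs_wor_error_squared[OF H[unfolded kor_kernel_eq_weighted_kernel[OF n]] cont lim P set_lattice_points]
    by (simp add: mset_mean_mset_mean_weighted_kernel[OF P] mset_mean_lattice_points_cos_series_diff[OF N])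
qed

lemma sum_power2_le_power2_sum:
  fixes f :: "'a \<Rightarrow> real"
  assumes "finite A" "\<And>x. x \<in> A \<Longrightarrow> f x \<ge> 0"
  shows "(\<Sum>x\<in>A. (f x)\<^sup>2) \<le> (\<Sum>x\<in>A. f x)\<^sup>2"
proof -
  have "(\<Sum>x\<in>A. (f x)\<^sup>2) \<le> (\<Sum>x\<in>A. f x * (\<Sum>x\<in>A. f x))"
    unfolding power2_eq_square using assms
    by (intro sum_mono mult_left_mono member_le_sum) auto
  then show ?thesis by (simp add: power2_eq_square sum_distrib_right)
qed

theorem theorem3:
  fixes N \<alpha> :: nat
    and z :: "nat ^ 's"
    and \<gamma> :: "'s set \<Rightarrow> real"
    and H_sob H_kor :: "((real ^ 's) \<Rightarrow> real) set"
    and ip_sob ip_kor :: "((real ^ 's) \<Rightarrow> real) \<Rightarrow> ((real ^ 's) \<Rightarrow> real) \<Rightarrow> real"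
  assumes "N \<ge> 1"
    and "\<And>j. z $ j \<in> {1..N - 1}"
    and "\<And>u. \<gamma> u \<ge> 0"
    and "even \<alpha>" and "\<alpha> > 0"
    and "rkhs (cbox 0 1) (sob_kernel \<alpha> \<gamma>) H_sob ip_sob"
    and "rkhs (cbox 0 1) (kor_kernel (real \<alpha> / 2) (\<lambda>u. sqrt (scaled_weights \<alpha> \<gamma> u))) H_kor ip_kor"
  shows "(wor_error (sym_lattice_points N z) H_sob (fun_norm ip_sob))\<^sup>2
           \<le> ereal (\<Sum>u\<in>{u. u \<noteq> {}}. scaled_weights \<alpha> \<gamma> u *
                (\<Sum>\<^sub>\<infinity>k\<in>dual_lattice N z u. \<Prod>j\<in>u. 1 / real_of_int (k j) ^ \<alpha>)\<^sup>2)
       \<and> ereal (\<Sum>u\<in>{u. u \<noteq> {}}. scaled_weights \<alpha> \<gamma> u *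
                (\<Sum>\<^sub>\<infinity>k\<in>dual_lattice N z u. \<Prod>j\<in>u. 1 / real_of_int (k j) ^ \<alpha>)\<^sup>2)
           \<le> (wor_error (lattice_points N z) H_kor (fun_norm ip_kor)) ^ 4"
proof -
  have N: "N > 0" using assms(1) by simp
  have n: "\<alpha> \<ge> 2" "even \<alpha>" using assms(4,5) by (auto elim: evenE)
  have w: "scaled_weights \<alpha> \<gamma> u \<ge> 0" for u
    unfolding scaled_weights_def using assms(3) by simp
  let ?S = "cos_product_mean \<alpha> N z"
  let ?e = "wor_error (lattice_points N z) H_kor (fun_norm ip_kor)"
  have "(wor_error (sym_lattice_points N z) H_sob (fun_norm ip_sob))\<^sup>2 \<le>
      ereal (\<Sum>u\<in>{u. u \<noteq> {}}. scaled_weights \<alpha> \<gamma> u * (?S u)\<^sup>2)"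
    unfolding wor_error_sob_squared[OF assms(4,5) N assms(6)] scaled_weights_def ereal_less_eq mult.assoc
    by (intro sum_mono mult_left_mono mset_mean_sym_kernel_sob_kernel_1_le assms N)
  moreover have "ereal (\<Sum>u\<in>{u. u \<noteq> {}}. scaled_weights \<alpha> \<gamma> u * (?S u)\<^sup>2) \<le> ?e ^ 4"
  proof -
    \<comment> \<open>The square roots in the Korobov weights ensure that squaring a summand of the
      squared error returns \<open>scaled_weights\<close>; bounding the sum of these squares by the
      square of the sum produces the fourth power.\<close>
    have "(\<Sum>u\<in>{u. u \<noteq> {}}. scaled_weights \<alpha> \<gamma> u * (?S u)\<^sup>2) =
        (\<Sum>u\<in>{u. u \<noteq> {}}. (sqrt (scaled_weights \<alpha> \<gamma> u) * ?S u)\<^sup>2)"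
      using w by (simp add: power_mult_distrib)
    also have "\<dots> \<le> (\<Sum>u\<in>{u. u \<noteq> {}}. sqrt (scaled_weights \<alpha> \<gamma> u) * ?S u)\<^sup>2"
      using w cos_product_mean_nonneg[OF n N, of z] by (intro sum_power2_le_power2_sum) auto
    finally have "ereal (\<Sum>u\<in>{u. u \<noteq> {}}. scaled_weights \<alpha> \<gamma> u * (?S u)\<^sup>2) \<le> (?e\<^sup>2)\<^sup>2"
      unfolding wor_error_kor_squared[OF n N assms(7)] by simp
    also have "(?e\<^sup>2)\<^sup>2 = ?e ^ 4" by (simp flip: power_mult)
    finally show ?thesis .
  qed
  ultimately show ?thesis
    unfolding infsum_dual_lattice[OF n N] by blast
qed

end
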